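(* Let $q$ be an odd prime power and $\mathcal{E}\subseteq\mathbb{F}_q^d$. \begin{itemize} \item If $q\geq5$, $d\in\{2,4\}$, $r\in\mathbb{F}_q^*$ and $|\mathcal{E}|\geq 36q^{(2d+1)/3}$, then $\mathcal{E}$ contains a pair of $4$-paths with dilation ratio $r$. \item If $d=3$, $r\in\mathbb{F}_q^+$ and $|\mathcal{E}|\geq 9q^{(2d+1)/3}$, then $\mathcal{E}$ contains a pair of $4$-paths with dilation ratio $r$. \item If $d=5$, $r\in\mathbb{F}_q^+$ and $|\mathcal{E}|\geq 12q^{3}$, then $\mathcal{E}$ contains a pair of $4$-paths with dilation ratio $r$. \item If $q\geq5$, $d\geq6$ is even, $r\in\mathbb{F}_q^*$ and $|\mathcal{E}|\geq 313q^{d/2}$, then $\mathcal{E}$ contains a pair of $4$-paths with dilation ratio $r$. \item If $d\geq7$ is odd, $r\in\mathbb{F}_q^+$ and $|\mathcal{E}|\geq 313q^{d/2}$, then $\mathcal{E}$ contains a pair of $4$-paths with dilation ratio $r$. \end{itemize}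
   Context: $\mathbb{F}_q$ is the finite field with $q$ elements, $\mathbb{F}_q^*$ its nonzero elements, and $\mathbb{F}_q^+$ the set of nonzero quadratic residues (nonzero squares) in $\mathbb{F}_q$. For $\bm{x}=(x_1,\ldots,x_d)\in\mathbb{F}_q^d$, $\|\bm{x}\|:=x_1^2+\cdots+x_d^2$. Let $G=(V,E)$ be a graph with $V=\{1,\ldots,n\}$ and $E\subseteq\binom{V}{2}$. A set $\mathcal{E}\subseteq\mathbb{F}_q^d$ contains a pair of $G$ with dilation ratio $r$ if there exist distinct $\bm{x}_1,\ldots,\bm{x}_n\in\mathcal{E}$ and distinct $\bm{y}_1,\ldots,\bm{y}_n\in\mathcal{E}$ such that $\|\bm{y}_i-\bm{y}_j\|=r\|\bm{x}_i-\bm{x}_j\|\neq0$ whenever $\{i,j\}\in E$. A $4$-path is the graph with vertex set $\{1,2,3,4,5\}$ and edge set $\{\{1,2\},\{2,3\},\{3,4\},\{4,5\}\}$. *)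

theory Defs
  imports "HOL-Analysis.Analysis"
begin

definition sqnorm :: "('a::field) ^ ('n::finite) \<Rightarrow> 'a" where
  "sqnorm x = (\<Sum>i\<in>UNIV. (x $ i)^2)"

definition nonzero_squares :: "('a::field) set" where
  "nonzero_squares = {r. r \<noteq> 0 \<and> (\<exists>s. r = s^2)}"

text \<open>Graph G with vertex set {1..n} and edge set Ed (a set of 2-subsets).
  S contains a pair of G with dilation ratio r.\<close>
definition contains_graph_pair ::
  "nat \<Rightarrow> nat set set \<Rightarrow> ('a::field) \<Rightarrow> ('a ^ ('n::finite)) set \<Rightarrow> bool" where
  "contains_graph_pair n Ed r S \<longleftrightarrow>
     (\<exists>x y. (\<forall>i\<in>{1..n}. x i \<in> S \<and> y i \<in> S) \<and> inj_on x {1..n} \<and> inj_on y {1..n} \<and>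
       (\<forall>i\<in>{1..n}. \<forall>j\<in>{1..n}. {i,j} \<in> Ed \<longrightarrow>
          sqnorm (y i - y j) = r * sqnorm (x i - x j) \<and> sqnorm (x i - x j) \<noteq> 0))"

definition path4_edges :: "nat set set" where
  "path4_edges = {{1,2},{2,3},{3,4},{4,5}}"

definition contains_4path_pair :: "('a::field) \<Rightarrow> ('a ^ ('n::finite)) set \<Rightarrow> bool" where
  "contains_4path_pair r S = contains_graph_pair 5 path4_edges r S"

end

(* Fix a nontrivial additive character and let nu(t) count the pairs of points of E at distance t.
   At nonzero frequencies the Fourier transform of nu is, up to Gauss sums, that of the distribution
   over spheres of the energy |E^(xi)|^2. For even dimension, or r a square, the Gauss sums at j and
   r j agree, so Parseval expresses the correlation sum_t nu(t) nu(r t) by a correlation of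
   nonnegative energies. Keeping only its isotropic term is enough to dominate nu(0)^2, which can be
   large in even dimension. Hence, once |E| >= 20 q^(d/2), the graph on E x E joining (x, y) to
   (x', y') when |y - y'| = r |x - x'| <> 0 has at least |E|^4 / (4 q) ordered edges. Its average
   degree exceeds 12 times the size of any sphere, so after passing to a subset of large minimum
   degree a 4-path can be chosen greedily: each earlier vertex forbids at most two spheres' worth of
   neighbours. *)
theory Submission
  imports Defs
begin

section \<open>Additive characters and the dot product\<close>

text \<open>Let \<open>H\<close> be a largest additive subgroup missing 1. Maximality makes every
  element congruent modulo \<open>H\<close> to an integer, and that integer is unique modulo the
  characteristic p. A primitive p-th root of unity raised to this integer is the character.\<close>

lemma ex_nontrivial_additive_character:
  "\<exists>\<psi> :: 'a::{field,finite} \<Rightarrow> complex.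
     (\<forall>x y. \<psi> (x + y) = \<psi> x * \<psi> y) \<and> (\<forall>x. norm (\<psi> x) = 1) \<and> (\<exists>x. \<psi> x \<noteq> 1)"
proof -
  define p where "p = CHAR('a)"
  have "p > 0" unfolding p_def by (rule finite_imp_CHAR_pos) simp
  then have "prime p" unfolding p_def by (rule prime_CHAR_semidom)
  have char: "of_int k = (0::'a) \<longleftrightarrow> int p dvd k" for k
    by (simp add: p_def of_int_eq_0_iff_char_dvd)
  define sg where "sg H \<longleftrightarrow> (0::'a) \<in> H \<and> 1 \<notin> H \<and> (\<forall>x\<in>H. \<forall>y\<in>H. x - y \<in> H)" for H
  have "\<exists>H. sg H \<and> (\<forall>K. sg K \<longrightarrow> card K \<le> card H)"
  proof (rule ex_has_greatest_nat[of sg "{0}" card "CARD('a) + 1"])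
    show "sg {0}" by (simp add: sg_def)
    show "\<forall>K. sg K \<longrightarrow> card K < CARD('a) + 1"
      by (simp add: card_mono less_Suc_eq_le)
  qed
  then obtain H where H: "sg H" and max: "\<And>K. sg K \<Longrightarrow> card K \<le> card H" by blast
  have H0: "0 \<in> H" and H1: "1 \<notin> H" and Hm: "\<And>x y. x \<in> H \<Longrightarrow> y \<in> H \<Longrightarrow> x - y \<in> H"
    using H by (auto simp: sg_def)
  have Hneg: "- x \<in> H" if "x \<in> H" for x using Hm[OF H0 that] by simp
  have Ha: "x + y \<in> H" if "x \<in> H" "y \<in> H" for x y using Hm[OF that(1) Hneg[OF that(2)]] by simp
  have Hn: "of_nat n * x \<in> H" if "x \<in> H" for n x
    by (induction n) (use that in \<open>auto simp: H0 algebra_simps intro: Ha\<close>)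
  have Hi: "of_int m * x \<in> H" if "x \<in> H" for m x
    by (cases m rule: int_cases2) (use Hn[OF that] Hneg in auto)
  \<comment> \<open>\<open>H\<close> is closed under integer multiples only, so division by an
    integer must be multiplication by another integer; Bezout supplies it.\<close>
  have inv: "\<exists>m'. of_int m' * of_int m = (1::'a)" if "of_int m \<noteq> (0::'a)" for m :: int
  proof -
    have "coprime m (int p)"
    proof -
      have "\<not> int p dvd m" using that char by blast
      moreover have "prime (int p)" using \<open>prime p\<close> by simp
      ultimately have "coprime (int p) m" by (rule prime_imp_coprime[rotated])
      then show ?thesis by (simp add: coprime_commute)
    qed
    then obtain u v where "u * m + v * int p = 1" using bezout_int by (metis coprime_imp_gcd_eq_1)
    then have "of_int (u * m + v * int p) = (1::'a)" by simp
    then have "of_int u * of_int m = (1::'a)" using char[of "int p"] by simp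
    then show ?thesis by blast
  qed
  have ex: "\<exists>k. x - of_int k \<in> H" for x
  proof (cases "x \<in> H")
    case True then show ?thesis by (intro exI[of _ 0]) simp
  next
    case False
    \<comment> \<open>The subgroup generated by \<open>H\<close> and \<open>x\<close>. Being larger
      than \<open>H\<close> it contains 1, and the relation expressing this is solved for
      \<open>x\<close>.\<close>
    define K where "K = {h + of_int m * x | h m. h \<in> H}"
    have "H \<subset> K"
    proof
      show "H \<subseteq> K" unfolding K_def by (intro subsetI CollectI exI[of _ "_::'a"] exI[of _ "0::int"]) auto
      have "x \<in> K" unfolding K_def using H0
        by (intro CollectI exI[of _ "0::'a"] exI[of _ "1::int"]) simp
      then show "H \<noteq> K" using False by blast
    qed
    then have "card H < card K" by (simp add: psubset_card_mono)
    then have "\<not> sg K" using max[of K] by linarith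
    moreover have "0 \<in> K" using \<open>H \<subset> K\<close> H0 by blast
    moreover have "a - b \<in> K" if ab: "a \<in> K" "b \<in> K" for a b
    proof -
      obtain h m h' m' where *: "a = h + of_int m * x" "h \<in> H" "b = h' + of_int m' * x" "h' \<in> H"
        using ab unfolding K_def by blast
      then have "a - b = (h - h') + of_int (m - m') * x" by (simp add: algebra_simps)
      then show ?thesis using Hm[of h h'] * unfolding K_def by blast
    qed
    ultimately have "1 \<in> K" unfolding sg_def by blast
    then obtain h m where hm: "1 = h + of_int m * x" "h \<in> H" unfolding K_def by blast
    have "of_int m \<noteq> (0::'a)" using hm H1 by auto
    then obtain m' where m': "of_int m' * of_int m = (1::'a)" using inv by blast
    have "x - of_int m' = - (of_int m' * h)"
    proof -
      have "of_int m' = of_int m' * h + (of_int m' * of_int m) * x"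
        using hm(1) by (metis distrib_left mult.assoc mult.right_neutral)
      then have "of_int m' = of_int m' * h + x" using m' by simp
      moreover have "y - a = - b" if "a = b + y" for a b y :: 'a using that by simp
      ultimately show ?thesis by blast
    qed
    then show ?thesis using Hneg[OF Hi[OF hm(2)]] by metis
  qed
  define e where "e k = cis (2 * pi * real_of_int k / real p)" for k
  have e_add: "e (k + l) = e k * e l" for k l
    by (simp add: e_def cis_mult add_divide_distrib distrib_left)
  have e_per: "e k = e l" if kl: "int p dvd k - l" for k l
  proof -
    obtain c where "k - l = int p * c" using kl by blast
    then have "k = l + int p * c" by simp
    moreover have "e (int p * c) = 1"
    proof -
      have "2 * pi * real_of_int (int p * c) / real p = 2 * pi * of_int c" using \<open>p > 0\<close> by simp
      then have "e (int p * c) = cis (2 * pi * of_int c)" unfolding e_def by (rule arg_cong)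
      also have "\<dots> = 1" by (rule cis_multiple_2pi) simp
      finally show ?thesis .
    qed
    ultimately show ?thesis by (simp add: e_add)
  qed
  \<comment> \<open>The chosen integer matters only modulo p: \<open>uniq\<close> and the
    periodicity of \<open>e\<close> make \<open>e (k x)\<close> independent of the choice.\<close>
  define k where "k x = (SOME k. x - of_int k \<in> H)" for x
  have k: "x - of_int (k x) \<in> H" for x unfolding k_def by (rule someI_ex[OF ex])
  have uniq: "int p dvd a - b" if "x - of_int a \<in> H" "x - of_int b \<in> H" for x a b
  proof (rule ccontr)
    assume "\<not> int p dvd a - b"
    then obtain m' where "of_int m' * of_int (a - b) = (1::'a)" using inv char by blast
    moreover have "of_int (a - b) \<in> H" using Hm[OF that(2,1)] by simp
    ultimately show False using Hi[of "of_int (a - b)" m'] H1 by simp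
  qed
  have "e (k (x + y)) = e (k x) * e (k y)" for x y
  proof -
    have "(x + y) - of_int (k x + k y) \<in> H" using Ha[OF k[of x] k[of y]] by (simp add: algebra_simps)
    then show ?thesis using uniq[OF k[of "x + y"]] e_per e_add by metis
  qed
  moreover have "norm (e (k x)) = 1" for x by (simp add: e_def)
  moreover have "e (k 1) \<noteq> 1"
  proof
    assume "e (k 1) = 1"
    moreover have "e (k 1) = e 1" by (rule e_per, rule uniq[of 1]) (use k[of 1] H0 in auto)
    ultimately have "cos (2 * pi / real p) = 1" unfolding e_def by (metis cis.sel(1) mult.right_neutral of_int_1 one_complex.sel(1))
    then obtain n :: int where "2 * pi / real p = of_int n * 2 * pi" unfolding cos_one_2pi_int by blast
    then have "1 = real_of_int n * real p" using \<open>p > 0\<close> by (simp add: field_simps)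
    then have "1 = n * int p" by (metis of_int_1 of_int_eq_iff of_int_mult of_int_of_nat_eq)
    then have "int p dvd 1" by (metis dvd_triv_right)
    then show False using \<open>prime p\<close> by simp
  qed
  ultimately show ?thesis by (intro exI[of _ "\<lambda>x. e (k x)"]) blast
qed

text \<open>Translating by \<open>v\<close> multiplies the sum by \<open>f v\<close>, which is not
  1. Stated for groups, so that it serves both the field and the vector space.\<close>

lemma sum_character_eq_0:
  fixes f :: "'g::{ab_group_add,finite} \<Rightarrow> complex"
  assumes add: "\<And>x y. f (x + y) = f x * f y" and "f v \<noteq> 1"
  shows "(\<Sum>x\<in>UNIV. f x) = 0"
proof -
  have "(\<Sum>x\<in>UNIV. f x) = (\<Sum>x\<in>UNIV. f (x + v))"
    by (rule sum.reindex_bij_witness[of _ "\<lambda>x. x + v" "\<lambda>x. x - v"]) auto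
  also have "\<dots> = (\<Sum>x\<in>UNIV. f x) * f v" by (simp add: add sum_distrib_right)
  finally show ?thesis using \<open>f v \<noteq> 1\<close> by (simp add: algebra_simps)
qed

section \<open>Bilinearity of the dot product and its relation to \<open>sqnorm\<close>\<close>

definition dot :: "'a::field ^ 'n::finite \<Rightarrow> 'a ^ 'n \<Rightarrow> 'a" where
  "dot x y = (\<Sum>i\<in>UNIV. x $ i * y $ i)"

lemma dot_add_right: "dot x (y + z) = dot x y + dot x z"
  by (simp add: dot_def distrib_left sum.distrib)

lemma dot_commute: "dot x y = dot y x"
  by (simp add: dot_def mult.commute)

lemma dot_add_left: "dot (x + y) z = dot x z + dot y z"
  by (simp add: dot_commute[of _ z] dot_add_right)

lemma dot_diff_right: "dot x (y - z) = dot x y - dot x z"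
  by (simp add: dot_def right_diff_distrib sum_subtractf)

lemma dot_scale_right: "dot x (c *s y) = c * dot x y"
  by (simp add: dot_def sum_distrib_left mult.left_commute)

lemma dot_scale_left: "dot (c *s x) y = c * dot x y"
  by (simp add: dot_def sum_distrib_left mult.assoc)

lemma sqnorm_eq_dot: "sqnorm x = dot x x"
  by (simp add: sqnorm_def dot_def power2_eq_square)

lemma sqnorm_minus_commute: "sqnorm (x - y) = sqnorm (y - x)"
  by (simp add: sqnorm_def power2_commute)

lemma sqnorm_zero [simp]: "sqnorm 0 = 0"
  by (simp add: sqnorm_def)

lemma sqnorm_add: "sqnorm (x + y) = sqnorm x + 2 * dot x y + sqnorm y"
  by (simp add: sqnorm_eq_dot dot_commute[of "x + y"] dot_add_right dot_commute[of y x])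

lemma sqnorm_scale: "sqnorm (c *s x) = c\<^sup>2 * sqnorm x"
  by (simp add: sqnorm_eq_dot dot_scale_left dot_scale_right power2_eq_square)

text \<open>Translation by 1 permutes the field, so summing all elements gives
  \<open>of_nat CARD('a) = 0\<close>; were 2 equal to 0, an odd cardinality would turn this into 1 =
  0.\<close>

lemma two_neq_zero_of_odd_card:
  assumes "odd CARD('a::{field,finite})"
  shows "(2::'a) \<noteq> 0"
proof
  assume "(2::'a) = 0"
  have "(\<Sum>x\<in>(UNIV::'a set). x) = (\<Sum>x\<in>(UNIV::'a set). x + 1)"
    by (rule sum.reindex_bij_witness[of _ "\<lambda>x. x + 1" "\<lambda>x. x - 1"]) auto
  also have "\<dots> = (\<Sum>x\<in>(UNIV::'a set). x) + of_nat CARD('a)" by (simp add: sum.distrib)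
  finally have "of_nat CARD('a) = (0::'a)" by simp
  moreover obtain k where "CARD('a) = 2 * k + 1" using assms by (rule oddE)
  ultimately show False using \<open>(2::'a) = 0\<close> by simp
qed

section \<open>Gauss sums\<close>

lemma card_square_roots_le_2: "card {x::'a::{field,finite}. x\<^sup>2 = s} \<le> 2"
proof (cases "\<exists>a. a\<^sup>2 = s")
  case True
  then obtain a where "a\<^sup>2 = s" by blast
  then have "{x. x\<^sup>2 = s} \<subseteq> {a, - a}" by (auto simp: power2_eq_iff)
  then have "card {x. x\<^sup>2 = s} \<le> card {a, - a}" by (intro card_mono) auto
  also have "\<dots> \<le> 2" by (simp add: card_insert_if)
  finally show ?thesis .
qed auto

text \<open>Pigeonhole: squaring is at most two to one and the cardinality is odd, so the squares
  \<open>S\<close> fill more than half of the field and must meet their reflection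
  \<open>j - S\<close>.\<close>

lemma sum_two_squares_of_odd_card:
  fixes j :: "'a::{field,finite}"
  assumes "odd CARD('a)"
  shows "\<exists>a b. j = a\<^sup>2 + b\<^sup>2"
proof -
  define S where "S = range (\<lambda>x::'a. x\<^sup>2)"
  have "CARD('a) = card (\<Union>s\<in>S. {x::'a. x\<^sup>2 = s})"
    by (rule arg_cong[where f = card]) (auto simp: S_def)
  also have "\<dots> \<le> (\<Sum>s\<in>S. card {x::'a. x\<^sup>2 = s})" by (rule card_UN_le) simp
  also have "\<dots> \<le> (\<Sum>s\<in>S. 2)" by (rule sum_mono) (rule card_square_roots_le_2)
  finally have "CARD('a) < 2 * card S" using assms by (cases "CARD('a) = 2 * card S") auto
  moreover have "card ((\<lambda>x. j - x) ` S) = card S" by (intro card_image inj_onI) simp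
  moreover have "card (S \<union> (\<lambda>x. j - x) ` S) \<le> CARD('a)" by (intro card_mono) auto
  ultimately have "S \<inter> (\<lambda>x. j - x) ` S \<noteq> {}" using card_Un_disjoint[of S "(\<lambda>x. j - x) ` S"] by auto
  then show ?thesis unfolding S_def by (force simp: algebra_simps)
qed

locale nontrivial_character =
  fixes \<psi> :: "'a::{field,finite} \<Rightarrow> complex"
  assumes add: "\<psi> (x + y) = \<psi> x * \<psi> y"
    and norm_eq_1: "norm (\<psi> x) = 1"
    and nontrivial: "\<exists>x. \<psi> x \<noteq> 1"
    and odd_card: "odd CARD('a)"
begin

lemma two_neq_zero: "(2::'a) \<noteq> 0"
  using odd_card by (rule two_neq_zero_of_odd_card)

lemma zero [simp]: "\<psi> 0 = 1"
proof -
  have "\<psi> 0 * \<psi> 0 = \<psi> 0" using add[of 0 0] by simp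
  moreover have "\<psi> 0 \<noteq> 0" using norm_eq_1[of 0] by auto
  ultimately show ?thesis by simp
qed

lemma cnj_eq: "cnj (\<psi> x) = \<psi> (- x)"
proof -
  have "\<psi> x * cnj (\<psi> x) = 1" using norm_eq_1[of x] by (simp add: complex_norm_square[symmetric])
  moreover have "\<psi> x * \<psi> (- x) = 1" by (simp add: add[symmetric])
  moreover have "\<psi> x \<noteq> 0" using norm_eq_1[of x] by auto
  ultimately show ?thesis by (metis mult_left_cancel)
qed

lemma diff: "\<psi> (x - y) = \<psi> x * cnj (\<psi> y)"
  using add[of x "- y"] by (simp add: cnj_eq)

lemma map_sum: "finite I \<Longrightarrow> \<psi> (\<Sum>i\<in>I. f i) = (\<Prod>i\<in>I. \<psi> (f i))"
  by (induction I rule: finite_induct) (simp_all add: add)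

lemma sum_scaled: "(\<Sum>x\<in>UNIV. \<psi> (c * x)) = (if c = 0 then of_nat CARD('a) else 0)"
proof (cases "c = 0")
  case False
  obtain v where "\<psi> v \<noteq> 1" using nontrivial by blast
  then have "(\<Sum>x\<in>UNIV. \<psi> (c * x)) = 0"
    using False by (intro sum_character_eq_0[of _ "v / c"]) (simp_all add: distrib_left add)
  then show ?thesis using False by simp
qed simp

text \<open>Orthogonality in the vector space. For nonzero \<open>c\<close> the translation used is
  an axis vector scaled so that its dot product with \<open>c\<close> is \<open>v\<close>.\<close>

lemma sum_dot: "(\<Sum>x\<in>UNIV. \<psi> (dot c x)) = (if c = 0 then of_nat CARD('a) ^ CARD('n) else 0)"
  for c :: "'a ^ 'n::finite"
proof (cases "c = 0")
  case True
  then show ?thesis by (simp add: dot_def)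
next
  case False
  then obtain i where i: "c $ i \<noteq> 0" by (auto simp: vec_eq_iff)
  obtain v where v: "\<psi> v \<noteq> 1" using nontrivial by blast
  have "dot c (axis i (v / c $ i)) = (\<Sum>k\<in>UNIV. if k = i then v else 0)"
    unfolding dot_def by (rule sum.cong) (use i in \<open>auto simp: axis_def\<close>)
  then have "dot c (axis i (v / c $ i)) = v" by simp
  then have "(\<Sum>x\<in>UNIV. \<psi> (dot c x)) = 0"
    using v by (intro sum_character_eq_0[of _ "axis i (v / c $ i)"]) (simp_all add: dot_add_right add)
  then show ?thesis using False by simp
qed

text \<open>The quadratic Gauss sum written as a sum over squares, so the value at 0 is the
  cardinality of the field.\<close>

definition gauss :: "'a \<Rightarrow> complex" where
  "gauss j = (\<Sum>x\<in>UNIV. \<psi> (j * x\<^sup>2))"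

lemma cnj_gauss: "cnj (gauss j) = gauss (- j)"
  by (simp add: gauss_def cnj_sum cnj_eq)

text \<open>Putting x = u + y makes the difference of squares linear in y; the sum over y then
  vanishes except at u = 0.\<close>

lemma gauss_mult_cnj:
  assumes "j \<noteq> 0"
  shows "gauss j * cnj (gauss j) = of_nat CARD('a)"
proof -
  have "gauss j * cnj (gauss j) = (\<Sum>y\<in>UNIV. \<Sum>x\<in>UNIV. \<psi> (j * (x\<^sup>2 - y\<^sup>2)))"
    by (subst sum.swap) (simp add: gauss_def cnj_sum sum_product right_diff_distrib diff)
  also have "\<dots> = (\<Sum>y\<in>UNIV. \<Sum>u\<in>UNIV. \<psi> (j * u\<^sup>2) * \<psi> (2 * j * u * y))"
  proof (rule sum.cong[OF refl])
    fix y :: 'a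
    show "(\<Sum>x\<in>UNIV. \<psi> (j * (x\<^sup>2 - y\<^sup>2))) = (\<Sum>u\<in>UNIV. \<psi> (j * u\<^sup>2) * \<psi> (2 * j * u * y))"
      by (rule sum.reindex_bij_witness[of _ "\<lambda>u. u + y" "\<lambda>x. x - y"])
         (auto simp: add[symmetric] power2_eq_square algebra_simps)
  qed
  also have "\<dots> = (\<Sum>u\<in>UNIV. \<psi> (j * u\<^sup>2) * (\<Sum>y\<in>UNIV. \<psi> (2 * j * u * y)))"
    by (subst sum.swap) (simp add: sum_distrib_left)
  also have "\<dots> = (\<Sum>u\<in>(UNIV::'a set). if u = 0 then of_nat CARD('a) else 0)"
    by (rule sum.cong) (use assms two_neq_zero in \<open>auto simp: sum_scaled\<close>)
  finally show ?thesis by simp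
qed

lemma norm_gauss:
  assumes "j \<noteq> 0"
  shows "norm (gauss j) = sqrt CARD('a)"
proof -
  have "complex_of_real ((norm (gauss j))\<^sup>2) = of_nat CARD('a)"
    by (metis complex_norm_square gauss_mult_cnj[OF assms])
  then have "(norm (gauss j))\<^sup>2 = CARD('a)" by (metis of_real_eq_iff of_real_of_nat_eq)
  then show ?thesis by (simp add: real_sqrt_unique)
qed

lemma gauss_mult_square:
  assumes "c \<noteq> 0"
  shows "gauss (j * c\<^sup>2) = gauss j"
  unfolding gauss_def
  by (rule sum.reindex_bij_witness[of _ "\<lambda>x. x / c" "\<lambda>x. c * x"])
     (use assms in \<open>auto simp: power_mult_distrib mult.assoc\<close>)

text \<open>If \<open>j = a\<^sup>2 + b\<^sup>2\<close>, then multiplication by \<open>a + bi\<close> is a similitude of the plane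
  with ratio \<open>j\<close>.\<close>
lemma gauss_square:
  assumes "j \<noteq> 0"
  shows "(gauss j)\<^sup>2 = (gauss 1)\<^sup>2"
proof -
  have sq: "(gauss k)\<^sup>2 = (\<Sum>(x, y)\<in>UNIV. \<psi> (k * (x\<^sup>2 + y\<^sup>2)))" for k
    by (simp add: gauss_def power2_eq_square[of "sum _ _"] sum_product sum.cartesian_product
        distrib_left add)
  obtain a b where j: "j = a\<^sup>2 + b\<^sup>2" using sum_two_squares_of_odd_card[OF odd_card] by blast
  \<comment> \<open>These two identities apply the conjugate similitude after \<open>T\<close>,
    which returns \<open>j\<close> times the vector; hence \<open>T\<close> is injective.\<close>
  have id1: "(a * (a * x - b * y) + b * (b * x + a * y)) = j * x" for x y
    by (simp add: j power2_eq_square algebra_simps)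
  have id2: "(a * (b * x + a * y) - b * (a * x - b * y)) = j * y" for x y
    by (simp add: j power2_eq_square algebra_simps)
  define T where "T = (\<lambda>(x, y). (a * x - b * y, b * x + a * y))"
  have inj: "inj T"
  proof (rule injI, clarify)
    fix x y x' y' assume "T (x, y) = T (x', y')"
    then have eq: "a * x - b * y = a * x' - b * y'" "b * x + a * y = b * x' + a * y'"
      by (simp_all add: T_def)
    have "j * x = j * x'" "j * y = j * y'" using id1 id2 eq by metis+
    then show "x = x' \<and> y = y'" using assms by simp
  qed
  have "(\<Sum>(x, y)\<in>UNIV. \<psi> (j * (x\<^sup>2 + y\<^sup>2)))
      = (\<Sum>p\<in>UNIV. (\<lambda>(x, y). \<psi> (1 * (x\<^sup>2 + y\<^sup>2))) (T p))"
    by (rule sum.cong) (auto simp: T_def j power2_eq_square algebra_simps)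
  also have "\<dots> = (\<Sum>(x, y)\<in>range T. \<psi> (1 * (x\<^sup>2 + y\<^sup>2)))"
    by (simp add: sum.reindex[OF inj] o_def)
  also have "range T = UNIV" using inj by (simp add: finite_UNIV_inj_surj)
  finally show ?thesis by (simp only: sq)
qed

text \<open>The character factorises over the coordinates, so the sum is a product of
  one-dimensional Gauss sums.\<close>

lemma sum_sqnorm: "(\<Sum>x\<in>(UNIV :: ('a ^ 'n::finite) set). \<psi> (j * sqnorm x)) = gauss j ^ CARD('n)"
proof -
  have "gauss j ^ CARD('n) = (\<Prod>i\<in>(UNIV::'n set). \<Sum>t\<in>UNIV. \<psi> (j * t\<^sup>2))"
    by (simp add: gauss_def)
  also have "\<dots> = (\<Sum>f\<in>(UNIV::'n set) \<rightarrow>\<^sub>E UNIV. \<Prod>i\<in>UNIV. \<psi> (j * (f i)\<^sup>2))"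
    by (rule prod_sum_PiE) auto
  also have "\<dots> = (\<Sum>x\<in>(UNIV :: ('a ^ 'n) set). \<Prod>i\<in>UNIV. \<psi> (j * (x $ i)\<^sup>2))"
    by (rule sum.reindex_bij_witness[of _ vec_nth vec_lambda]) auto
  also have "\<dots> = (\<Sum>x\<in>(UNIV :: ('a ^ 'n) set). \<psi> (j * sqnorm x))"
    by (simp add: sqnorm_def sum_distrib_left map_sum)
  finally show ?thesis ..
qed

lemma four_neq_zero: "(4::'a) \<noteq> 0"
proof -
  have "(4::'a) = 2\<^sup>2" by simp
  then show ?thesis by (metis power_not_zero two_neq_zero)
qed

text \<open>The arguments \<open>- 1 / (4 * j)\<close> and \<open>- j\<close> differ by the square
  factor \<open>(2 * j)\<^sup>2\<close>.\<close>

lemma gauss_neg_inverse_4: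
  assumes "j \<noteq> 0"
  shows "gauss (- 1 / (4 * j)) = cnj (gauss j)"
proof -
  have "gauss (- 1 / (4 * j)) = gauss (- 1 / (4 * j) * (2 * j)\<^sup>2)"
    using assms two_neq_zero by (intro gauss_mult_square[symmetric]) simp
  also have "- 1 / (4 * j) * (2 * j)\<^sup>2 = - j"
    using assms four_neq_zero by (simp add: field_simps power2_eq_square)
  finally show ?thesis by (simp add: cnj_gauss)
qed

text \<open>The finite-field form of the fact that a Gaussian is the Fourier transform of a Gaussian
  at the reciprocal frequency: translating \<xi> by \<open>(2 * j) *s u\<close> completes the
  square.\<close>

lemma complete_square:
  fixes u :: "'a ^ 'n::finite"
  assumes "j \<noteq> 0"
  shows "of_nat CARD('a) ^ CARD('n) * \<psi> (j * sqnorm u) =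
    gauss j ^ CARD('n) * (\<Sum>\<xi>\<in>UNIV. \<psi> (- 1 / (4 * j) * sqnorm \<xi>) * \<psi> (dot \<xi> u))"
proof -
  have eq: "- 1 / (4 * j) * sqnorm (\<xi> + (2 * j) *s u) + dot (\<xi> + (2 * j) *s u) u
      = j * sqnorm u + - 1 / (4 * j) * sqnorm \<xi>" for \<xi>
  proof -
    have "sqnorm (\<xi> + (2 * j) *s u) = sqnorm \<xi> + 4 * j * dot \<xi> u + 4 * j\<^sup>2 * sqnorm u"
      by (simp add: sqnorm_add dot_scale_right sqnorm_scale power2_eq_square)
    moreover have "dot (\<xi> + (2 * j) *s u) u = dot \<xi> u + 2 * j * sqnorm u"
      by (simp add: dot_add_left dot_scale_left sqnorm_eq_dot)
    ultimately show ?thesis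
      using assms four_neq_zero by (simp add: field_simps power2_eq_square)
  qed
  have "(\<Sum>\<xi>\<in>UNIV. \<psi> (- 1 / (4 * j) * sqnorm \<xi>) * \<psi> (dot \<xi> u))
      = (\<Sum>\<xi>\<in>UNIV. \<psi> (- 1 / (4 * j) * sqnorm (\<xi> + (2 * j) *s u) + dot (\<xi> + (2 * j) *s u) u))"
    unfolding add[symmetric]
    by (rule sum.reindex_bij_witness[of _ "\<lambda>\<xi>. \<xi> + (2 * j) *s u" "\<lambda>\<xi>. \<xi> - (2 * j) *s u"]) auto
  also have "\<dots> = \<psi> (j * sqnorm u) * gauss (- 1 / (4 * j)) ^ CARD('n)"
    unfolding eq add by (simp only: sum_distrib_left[symmetric] sum_sqnorm)
  also have "gauss (- 1 / (4 * j)) = cnj (gauss j)" using assms by (rule gauss_neg_inverse_4)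
  finally show ?thesis
    using gauss_mult_cnj[OF assms] by (simp add: power_mult_distrib[symmetric] mult.left_commute)
qed

end

section \<open>Distances and Fourier energies\<close>

text \<open>Pairs are ordered and the diagonal is included, so the counts over all \<open>t\<close>
  add up to the square of \<open>card E\<close>.\<close>

definition dist_count :: "('a::{field,finite} ^ 'n::finite) set \<Rightarrow> 'a \<Rightarrow> nat" where
  "dist_count E t = card {(x, y) \<in> E \<times> E. sqnorm (x - y) = t}"

section \<open>Fourier inversion and Parseval on the field, and the energy of a point set\<close>

context nontrivial_character
begin

text \<open>Unnormalised: inversion and Parseval therefore carry a factor
  \<open>CARD('a)\<close>.\<close>

definition fourier :: "('a \<Rightarrow> real) \<Rightarrow> 'a \<Rightarrow> complex" where
  "fourier f j = (\<Sum>t\<in>UNIV. of_real (f t) * \<psi> (j * t))"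

lemma fourier_0: "fourier f 0 = of_real (\<Sum>t\<in>UNIV. f t)"
  by (simp add: fourier_def)

lemma sum_fourier_mult:
  "(\<Sum>j\<in>UNIV. fourier f j * \<psi> (- (j * s))) = of_nat CARD('a) * of_real (f s)"
proof -
  have "(\<Sum>j\<in>UNIV. fourier f j * \<psi> (- (j * s)))
      = (\<Sum>j\<in>UNIV. \<Sum>t\<in>UNIV. of_real (f t) * \<psi> ((t - s) * j))"
  proof -
    have "\<psi> ((t - s) * j) = \<psi> (j * t) * \<psi> (- (j * s))" for t j
    proof -
      have "(t - s) * j = j * t + - (j * s)" by (simp add: algebra_simps)
      then show ?thesis by (simp only: add)
    qed
    then show ?thesis by (simp only: fourier_def sum_distrib_right mult.assoc)
  qed
  also have "\<dots> = (\<Sum>t\<in>UNIV. of_real (f t) * (\<Sum>j\<in>UNIV. \<psi> ((t - s) * j)))"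
    by (subst sum.swap) (simp add: sum_distrib_left)
  also have "\<dots> = (\<Sum>t\<in>UNIV. if t = s then of_real (f t) * of_nat CARD('a) else 0)"
    by (rule sum.cong) (simp_all add: sum_scaled)
  finally show ?thesis by simp
qed

lemma sum_fourier: "(\<Sum>j\<in>UNIV. fourier f j) = of_nat CARD('a) * of_real (f 0)"
  using sum_fourier_mult[of f 0] by simp

text \<open>A dilation by \<open>c\<close> in frequency becomes a dilation by \<open>c\<close> in
  one argument of the correlation. Only \<open>f\<close> is expanded; the sum over frequencies is
  then the inversion of \<open>h\<close> at \<open>c * t\<close>.\<close>

lemma parseval:
  "(\<Sum>j\<in>UNIV. fourier f (c * j) * cnj (fourier h j))
    = of_nat CARD('a) * of_real (\<Sum>t\<in>UNIV. f t * h (c * t))"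
proof -
  have "(\<Sum>j\<in>UNIV. fourier f (c * j) * cnj (fourier h j))
      = (\<Sum>j\<in>UNIV. cnj (\<Sum>t\<in>UNIV. of_real (f t) * (fourier h j * \<psi> (- (j * (c * t))))))"
    by (simp add: fourier_def[of f] cnj_sum cnj_eq sum_distrib_left sum_distrib_right mult_ac)
  also have "\<dots> = cnj (\<Sum>t\<in>UNIV. of_real (f t) * (\<Sum>j\<in>UNIV. fourier h j * \<psi> (- (j * (c * t)))))"
    unfolding cnj_sum[symmetric] by (subst sum.swap) (simp only: sum_distrib_left)
  also have "\<dots> = of_nat CARD('a) * of_real (\<Sum>t\<in>UNIV. f t * h (c * t))"
    unfolding sum_fourier_mult by (simp add: sum_distrib_left mult_ac)
  finally show ?thesis .
qed

text \<open>Transform of the push-forward of a weight along \<open>s\<close>. Distance counts, level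
  energies and sphere sizes are all of this shape.\<close>

lemma fourier_fibre_sum:
  assumes "finite X"
  shows "fourier (\<lambda>t. \<Sum>x | x \<in> X \<and> s x = t. w x) j = (\<Sum>x\<in>X. of_real (w x) * \<psi> (j * s x))"
proof -
  have "fourier (\<lambda>t. \<Sum>x | x \<in> X \<and> s x = t. w x) j
      = (\<Sum>t\<in>UNIV. \<Sum>x | x \<in> X \<and> s x = t. of_real (w x) * \<psi> (j * s x))"
    by (simp add: fourier_def sum_distrib_right)
  also have "\<dots> = (\<Sum>x\<in>X. of_real (w x) * \<psi> (j * s x))"
    by (rule sum.group) (use assms in auto)
  finally show ?thesis .
qed

text \<open>Squared modulus of the Fourier transform of the indicator function of
  \<open>E\<close>.\<close>

definition energy :: "('a ^ 'n::finite) set \<Rightarrow> 'a ^ 'n \<Rightarrow> real" where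
  "energy E \<xi> = (cmod (\<Sum>x\<in>E. \<psi> (dot \<xi> x)))\<^sup>2"

definition level_energy :: "('a ^ 'n::finite) set \<Rightarrow> 'a \<Rightarrow> real" where
  "level_energy E a = (\<Sum>\<xi> | \<xi> \<in> UNIV \<and> sqnorm \<xi> = a. energy E \<xi>)"

lemma level_energy_nonneg: "0 \<le> level_energy E a"
  by (simp add: level_energy_def energy_def sum_nonneg)

lemma fourier_level_energy:
  "fourier (level_energy E) k = (\<Sum>\<xi>\<in>UNIV. of_real (energy E \<xi>) * \<psi> (k * sqnorm \<xi>))"
proof -
  have "level_energy E = (\<lambda>a. \<Sum>\<xi> | \<xi> \<in> UNIV \<and> sqnorm \<xi> = a. energy E \<xi>)"
    by (rule ext) (rule level_energy_def)
  then show ?thesis by (simp only: fourier_fibre_sum[OF finite])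
qed

lemma energy_eq: "complex_of_real (energy E \<xi>) = (\<Sum>x\<in>E. \<Sum>y\<in>E. \<psi> (dot \<xi> (x - y)))"
  unfolding energy_def complex_norm_square
  by (simp add: cnj_sum sum_product dot_diff_right diff)

text \<open>Plancherel for the indicator of \<open>E\<close>: summing over all frequencies leaves
  only the diagonal x = y.\<close>

lemma sum_level_energy:
  "(\<Sum>a\<in>UNIV. level_energy E a) = real CARD('a) ^ CARD('n) * real (card E)"
  for E :: "('a ^ 'n::finite) set"
proof -
  have "complex_of_real (\<Sum>a\<in>UNIV. level_energy E a) = complex_of_real (\<Sum>\<xi>\<in>UNIV. energy E \<xi>)"
    unfolding level_energy_def by (rule arg_cong[where f = of_real], rule sum.group) auto
  also have "\<dots> = (\<Sum>\<xi>\<in>UNIV. \<Sum>x\<in>E. \<Sum>y\<in>E. \<psi> (dot \<xi> (x - y)))"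
    by (simp add: energy_eq)
  also have "\<dots> = (\<Sum>x\<in>E. \<Sum>y\<in>E. \<Sum>\<xi>\<in>UNIV. \<psi> (dot \<xi> (x - y)))"
    by (subst sum.swap, subst sum.swap[of _ E UNIV], rule refl)
  also have "\<dots> = (\<Sum>x\<in>E. \<Sum>y\<in>E. if x = y then of_nat CARD('a) ^ CARD('n) else 0)"
    by (simp add: dot_commute[of _ "_ - _"] sum_dot)
  also have "\<dots> = of_real (real CARD('a) ^ CARD('n) * real (card E))"
    by simp
  finally show ?thesis by (simp only: of_real_eq_iff)
qed

lemma fourier_dist_count:
  "fourier (\<lambda>t. real (dist_count E t)) j = (\<Sum>x\<in>E. \<Sum>y\<in>E. \<psi> (j * sqnorm (x - y)))"
proof -
  have eq: "real (dist_count E t) = (\<Sum>p | p \<in> E \<times> E \<and> sqnorm (fst p - snd p) = t. 1)" for t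
    by (simp add: dist_count_def) (rule arg_cong[where f = card], auto)
  show ?thesis unfolding eq
    by (subst fourier_fibre_sum) (simp_all add: sum.cartesian_product case_prod_unfold)
qed

lemma sum_dist_count: "(\<Sum>t\<in>UNIV. real (dist_count E t)) = real (card E) ^ 2"
  for E :: "('a ^ 'n::finite) set"
proof -
  have "complex_of_real (\<Sum>t\<in>UNIV. real (dist_count E t)) = of_real (real (card E) ^ 2)"
    using fourier_0[of "\<lambda>t. real (dist_count E t)"] unfolding fourier_dist_count
    by (simp add: power2_eq_square)
  then show ?thesis by (simp only: of_real_eq_iff)
qed

text \<open>Apply \<open>complete_square\<close> to each difference x - y; summing the linear
  characters over the pairs yields the energy.\<close>

lemma fourier_dist_count_eq_level_energy:
  fixes E :: "('a ^ 'n::finite) set"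
  assumes "j \<noteq> 0"
  shows "of_nat CARD('a) ^ CARD('n) * fourier (\<lambda>t. real (dist_count E t)) j
    = gauss j ^ CARD('n) * fourier (level_energy E) (- 1 / (4 * j))"
proof -
  have "of_nat CARD('a) ^ CARD('n) * fourier (\<lambda>t. real (dist_count E t)) j
      = (\<Sum>x\<in>E. \<Sum>y\<in>E. of_nat CARD('a) ^ CARD('n) * \<psi> (j * sqnorm (x - y)))"
    by (simp add: fourier_dist_count sum_distrib_left)
  also have "\<dots> = gauss j ^ CARD('n) *
      (\<Sum>x\<in>E. \<Sum>y\<in>E. \<Sum>\<xi>\<in>UNIV. \<psi> (- 1 / (4 * j) * sqnorm \<xi>) * \<psi> (dot \<xi> (x - y)))"
    by (simp only: complete_square[OF assms] sum_distrib_left)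
  also have "(\<Sum>x\<in>E. \<Sum>y\<in>E. \<Sum>\<xi>\<in>UNIV. \<psi> (- 1 / (4 * j) * sqnorm \<xi>) * \<psi> (dot \<xi> (x - y)))
      = (\<Sum>\<xi>\<in>UNIV. \<Sum>x\<in>E. \<Sum>y\<in>E. \<psi> (- 1 / (4 * j) * sqnorm \<xi>) * \<psi> (dot \<xi> (x - y)))"
    by (subst sum.swap[of _ E UNIV], subst sum.swap[of _ UNIV E], rule refl)
  also have "\<dots> = (\<Sum>\<xi>\<in>UNIV. \<psi> (- 1 / (4 * j) * sqnorm \<xi>) * of_real (energy E \<xi>))"
    by (simp only: energy_eq sum_distrib_left)
  also have "\<dots> = fourier (level_energy E) (- 1 / (4 * j))"
    by (simp only: fourier_level_energy mult.commute)
  finally show ?thesis .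
qed

text \<open>The map is its own inverse, so sums over nonzero frequencies may be taken over the dual
  ones instead.\<close>

lemma bij_betw_neg_inverse_4:
  "bij_betw (\<lambda>j::'a. - 1 / (4 * j)) (UNIV - {0}) (UNIV - {0})"
  by (rule bij_betw_byWitness[where f' = "\<lambda>j. - 1 / (4 * j)"])
     (use four_neq_zero in auto)

lemma sum_nonzero_neg_inverse_4:
  "(\<Sum>j\<in>UNIV - {0::'a}. f (- 1 / (4 * j))) = (\<Sum>k\<in>UNIV - {0}. f k)"
  using bij_betw_neg_inverse_4 by (rule sum.reindex_bij_betw)

text \<open>The distance distribution at frequency \<open>j\<close> is, up to a Gauss sum, the distribution of the
  Fourier energy over the spheres at frequency \<open>-1/(4j)\<close>; if the Gauss sums at \<open>j\<close> and
  \<open>r j\<close> agree, their product has absolute value \<open>q\<^sup>d\<close> and the correlation becomes one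
  of nonnegative energies.\<close>
lemma dist_count_correlation_ge:
  fixes E :: "('a ^ 'n::finite) set"
  assumes "r \<noteq> 0" and gauss_eq: "\<And>j. gauss (r * j) ^ CARD('n) = gauss j ^ CARD('n)"
  defines "Q \<equiv> real CARD('a) ^ CARD('n)" and "A \<equiv> real (card E)"
  shows "real CARD('a) * (\<Sum>t\<in>UNIV. real (dist_count E t) * real (dist_count E (r * t)))
    \<ge> A ^ 4 + real CARD('a) * (level_energy E 0)\<^sup>2 / Q - Q * A\<^sup>2"
proof -
  define \<nu> where "\<nu> = (\<lambda>t. real (dist_count E t))"
  define P where "P = level_energy E"
  define N where "N = (\<Sum>t\<in>UNIV. \<nu> t * \<nu> (r * t))"
  define M where "M = (\<Sum>t\<in>UNIV. P t * P (inverse r * t))"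
  have "Q > 0" unfolding Q_def by simp
  have F: "of_real Q * fourier \<nu> j = gauss j ^ CARD('n) * fourier P (- 1 / (4 * j))" if "j \<noteq> 0" for j
    using fourier_dist_count_eq_level_energy[OF that, of E] by (simp add: Q_def \<nu>_def P_def)
  have "complex_of_real (Q\<^sup>2) * (\<Sum>j\<in>UNIV - {0}. fourier \<nu> (r * j) * cnj (fourier \<nu> j))
      = (\<Sum>j\<in>UNIV - {0}. (of_real Q * fourier \<nu> (r * j)) * cnj (of_real Q * fourier \<nu> j))"
    by (simp add: sum_distrib_left power2_eq_square mult_ac)
  also have "\<dots> = (\<Sum>j\<in>UNIV - {0}. of_real Q *
      (fourier P (inverse r * (- 1 / (4 * j))) * cnj (fourier P (- 1 / (4 * j)))))"
  proof (rule sum.cong[OF refl])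
    fix j :: 'a assume "j \<in> UNIV - {0}"
    then have j: "j \<noteq> 0" "r * j \<noteq> 0" using assms by auto
    have "gauss j ^ CARD('n) * cnj (gauss j ^ CARD('n)) = of_real Q"
      using gauss_mult_cnj[OF j(1)] by (simp add: Q_def power_mult_distrib[symmetric])
    moreover have "- 1 / (4 * (r * j)) = inverse r * (- 1 / (4 * j))"
      by (simp add: inverse_eq_divide mult.left_commute)
    moreover have split: "(g * X) * cnj (g * Y) = (g * cnj g) * (X * cnj Y)" for g X Y by simp
    ultimately show "(of_real Q * fourier \<nu> (r * j)) * cnj (of_real Q * fourier \<nu> j) =
      of_real Q * (fourier P (inverse r * (- 1 / (4 * j))) * cnj (fourier P (- 1 / (4 * j))))"
      unfolding F[OF j(1)] F[OF j(2)] gauss_eq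
      by (simp only: split)
  qed
  also have "\<dots> = of_real Q * (\<Sum>k\<in>UNIV - {0}. fourier P (inverse r * k) * cnj (fourier P k))"
    unfolding sum_distrib_left[symmetric]
    by (rule arg_cong[where f = "(*) (of_real Q)"])
       (rule sum_nonzero_neg_inverse_4[of "\<lambda>k. fourier P (inverse r * k) * cnj (fourier P k)"])
  \<comment> \<open>Parseval runs over all frequencies, so the zero frequency, the square of the
    total energy \<open>Q * A\<close>, is subtracted.\<close>
  also have "(\<Sum>k\<in>UNIV - {0}. fourier P (inverse r * k) * cnj (fourier P k))
      = of_real (real CARD('a) * M - (Q * A)\<^sup>2)"
  proof -
    have "(\<Sum>k\<in>UNIV. fourier P (inverse r * k) * cnj (fourier P k))
      = fourier P 0 * cnj (fourier P 0) + (\<Sum>k\<in>UNIV - {0}. fourier P (inverse r * k) * cnj (fourier P k))"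
      by (subst sum.remove[of _ 0]) auto
    moreover have "fourier P 0 = of_real (Q * A)"
      by (simp only: fourier_0 P_def sum_level_energy Q_def A_def)
    ultimately show ?thesis unfolding parseval M_def by (simp add: power2_eq_square algebra_simps)
  qed
  also have "(\<Sum>j\<in>UNIV - {0}. fourier \<nu> (r * j) * cnj (fourier \<nu> j))
      = of_real (real CARD('a) * N - A ^ 4)"
  proof -
    have "(\<Sum>j\<in>UNIV. fourier \<nu> (r * j) * cnj (fourier \<nu> j))
      = fourier \<nu> 0 * cnj (fourier \<nu> 0) + (\<Sum>j\<in>UNIV - {0}. fourier \<nu> (r * j) * cnj (fourier \<nu> j))"
      by (subst sum.remove[of _ 0]) auto
    moreover have "fourier \<nu> 0 = of_real (A\<^sup>2)"
      by (simp only: fourier_0 \<nu>_def sum_dist_count A_def)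
    ultimately show ?thesis unfolding parseval N_def by (simp add: eval_nat_numeral algebra_simps)
  qed
  finally have "complex_of_real (Q\<^sup>2 * (real CARD('a) * N - A ^ 4))
      = of_real (Q * (real CARD('a) * M - (Q * A)\<^sup>2))" by simp
  then have *: "Q\<^sup>2 * (real CARD('a) * N - A ^ 4) = Q * (real CARD('a) * M - (Q * A)\<^sup>2)"
    by (simp only: of_real_eq_iff)
  have "real CARD('a) * N = A ^ 4 + real CARD('a) * M / Q - Q * A\<^sup>2"
  proof -
    have "X = Y / Q" if "Q\<^sup>2 * X = Q * Y" for X Y
      using that \<open>Q > 0\<close> by (simp add: field_simps power2_eq_square)
    from this[OF *] show ?thesis
      using \<open>Q > 0\<close> by (simp add: diff_divide_distrib power2_eq_square algebra_simps)
  qed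
  \<comment> \<open>All terms of \<open>M\<close> are nonnegative, so the isotropic one at t = 0 is
    a lower bound.\<close>
  moreover have "M \<ge> (P 0)\<^sup>2"
  proof -
    have "(\<Sum>t\<in>{0}. P t * P (inverse r * t)) \<le> M"
      unfolding M_def by (rule sum_mono2) (auto simp: P_def level_energy_nonneg)
    then show ?thesis by (simp add: power2_eq_square)
  qed
  then have "real CARD('a) * (P 0)\<^sup>2 / Q \<le> real CARD('a) * M / Q"
    using \<open>Q > 0\<close> by (intro divide_right_mono mult_left_mono) auto
  ultimately show ?thesis unfolding N_def \<nu>_def P_def by linarith
qed

end

section \<open>Pairs at distance zero and spheres\<close>

context nontrivial_character
begin

lemma gauss_0: "gauss 0 = of_nat CARD('a)"
  by (simp add: gauss_def)

lemma norm_gauss_power: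
  "j \<noteq> 0 \<Longrightarrow> norm (gauss j ^ m) = sqrt CARD('a) ^ m"
  by (simp add: norm_power norm_gauss)

lemma gauss_power_even:
  assumes "even m" "j \<noteq> 0"
  shows "gauss j ^ m = gauss 1 ^ m"
  using assms gauss_square[of j] by (auto elim!: evenE simp: power_mult)

text \<open>An even power is the same at 1 and at -1, hence fixed by conjugation and real; its
  modulus leaves a sign undetermined, so later arguments treat both signs.\<close>

lemma gauss_power_even_real:
  assumes "even m"
  shows "gauss 1 ^ m = of_real (sqrt CARD('a) ^ m) \<or> gauss 1 ^ m = - of_real (sqrt CARD('a) ^ m)"
proof -
  have "cnj (gauss 1 ^ m) = gauss 1 ^ m"
    using gauss_power_even[OF assms, of "- 1"] by (simp add: cnj_gauss)
  then have real: "of_real (Re (gauss 1 ^ m)) = gauss 1 ^ m" by (metis Reals_cnj_iff of_real_Re)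
  then have "\<bar>Re (gauss 1 ^ m)\<bar> = sqrt CARD('a) ^ m"
    using norm_gauss_power[of 1 m] by (metis norm_of_real one_neq_zero)
  then show ?thesis using real by (metis abs_eq_iff abs_if minus_equation_iff of_real_minus)
qed

text \<open>Fourier inversion at distance 0, with the zero frequency split off and the others moved
  to the dual frequencies \<open>- 1 / (4 * j)\<close>.\<close>

lemma dist_count_0_eq:
  fixes E :: "('a ^ 'n::finite) set"
  shows "complex_of_real (real CARD('a) * real CARD('a) ^ CARD('n) * real (dist_count E 0))
    = of_real (real CARD('a) ^ CARD('n) * (real (card E))\<^sup>2) +
      (\<Sum>k\<in>UNIV - {0}. cnj (gauss k) ^ CARD('n) * fourier (level_energy E) k)"
proof -
  let ?\<nu> = "\<lambda>t. real (dist_count E t)"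
  let ?Q = "of_nat CARD('a) ^ CARD('n) :: complex"
  have "complex_of_real (real CARD('a) * real CARD('a) ^ CARD('n) * real (dist_count E 0))
      = ?Q * (\<Sum>j\<in>UNIV. fourier ?\<nu> j)"
    by (simp add: sum_fourier)
  also have "\<dots> = ?Q * fourier ?\<nu> 0 + (\<Sum>j\<in>UNIV - {0}. ?Q * fourier ?\<nu> j)"
    by (subst sum.remove[of _ 0]) (auto simp: distrib_left sum_distrib_left)
  also have "(\<Sum>j\<in>UNIV - {0}. ?Q * fourier ?\<nu> j)
      = (\<Sum>j\<in>UNIV - {0}. cnj (gauss (- 1 / (4 * j))) ^ CARD('n) * fourier (level_energy E) (- 1 / (4 * j)))"
  proof (rule sum.cong[OF refl])
    fix j :: 'a assume "j \<in> UNIV - {0}"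
    then have j: "j \<noteq> 0" by simp
    show "?Q * fourier ?\<nu> j = cnj (gauss (- 1 / (4 * j))) ^ CARD('n) * fourier (level_energy E) (- 1 / (4 * j))"
      by (simp only: fourier_dist_count_eq_level_energy[OF j] gauss_neg_inverse_4[OF j] complex_cnj_cnj)
  qed
  also have "\<dots> = (\<Sum>k\<in>UNIV - {0}. cnj (gauss k) ^ CARD('n) * fourier (level_energy E) k)"
    by (rule sum_nonzero_neg_inverse_4[of "\<lambda>k. cnj (gauss k) ^ CARD('n) * fourier (level_energy E) k"])
  also have "?Q * fourier ?\<nu> 0 = of_real (real CARD('a) ^ CARD('n) * (real (card E))\<^sup>2)"
    unfolding fourier_0 sum_dist_count by simp
  finally show ?thesis .
qed

text \<open>In even dimension the Gauss factor is one constant, \<open>B\<close> or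
  \<open>- B\<close>, so inversion leaves the level energy at 0. With the positive sign it survives
  as the term over \<open>B\<close>; with the negative sign it only lowers the count and
  \<open>B * A / q\<close> remains.\<close>

lemma dist_count_0_le_even:
  fixes E :: "('a ^ 'n::finite) set"
  assumes "even CARD('n)"
  defines "B \<equiv> sqrt CARD('a) ^ CARD('n)" and "A \<equiv> real (card E)" and "q \<equiv> real CARD('a)"
  shows "real (dist_count E 0) \<le> A\<^sup>2 / q + level_energy E 0 / B \<or>
    real (dist_count E 0) \<le> A\<^sup>2 / q + B * A / q"
proof -
  define P0 where "P0 = level_energy E 0"
  have B2: "q ^ CARD('n) = B\<^sup>2"
    by (simp add: q_def B_def power2_eq_square flip: power_mult_distrib)
  have "B > 0" "q > 0" by (simp_all add: B_def q_def)
  have "P0 \<ge> 0" by (simp add: P0_def level_energy_nonneg)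
  have "(\<Sum>k\<in>UNIV - {0}. cnj (gauss k) ^ CARD('n) * fourier (level_energy E) k)
      = (\<Sum>k\<in>UNIV - {0}. gauss 1 ^ CARD('n) * fourier (level_energy E) k)"
  proof (rule sum.cong[OF refl])
    fix k :: 'a assume "k \<in> UNIV - {0}"
    then have "gauss (- k) ^ CARD('n) = gauss 1 ^ CARD('n)" by (intro gauss_power_even[OF assms(1)]) simp
    then show "cnj (gauss k) ^ CARD('n) * fourier (level_energy E) k
      = gauss 1 ^ CARD('n) * fourier (level_energy E) k" by (simp only: cnj_gauss)
  qed
  also have "\<dots> = gauss 1 ^ CARD('n) * ((\<Sum>k\<in>UNIV. fourier (level_energy E) k) - fourier (level_energy E) 0)"
    by (simp add: sum_distrib_left[symmetric] sum_diff1)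
  also have "\<dots> = gauss 1 ^ CARD('n) * of_real (q * P0 - B\<^sup>2 * A)"
    by (simp only: sum_fourier fourier_0 sum_level_energy P0_def q_def[symmetric] A_def[symmetric] B2) (simp add: q_def)
  finally have sum: "complex_of_real (q * B\<^sup>2 * real (dist_count E 0))
      = of_real (B\<^sup>2 * A\<^sup>2) + gauss 1 ^ CARD('n) * of_real (q * P0 - B\<^sup>2 * A)"
    using dist_count_0_eq[of E] by (simp only: q_def[symmetric] A_def[symmetric] B2)
  from gauss_power_even_real[OF assms(1)] show ?thesis
  proof
    assume "gauss 1 ^ CARD('n) = of_real (sqrt CARD('a) ^ CARD('n))"
    then have "complex_of_real (q * B\<^sup>2 * real (dist_count E 0))
      = of_real (B\<^sup>2 * A\<^sup>2 + B * (q * P0 - B\<^sup>2 * A))" using sum by (simp add: B_def)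
    then have "q * B\<^sup>2 * real (dist_count E 0) = B\<^sup>2 * A\<^sup>2 + B * (q * P0 - B\<^sup>2 * A)"
      by (simp only: of_real_eq_iff)
    also have "\<dots> \<le> B\<^sup>2 * A\<^sup>2 + B * (q * P0)"
      using \<open>B > 0\<close> by (simp add: A_def)
    also have "\<dots> = q * B\<^sup>2 * (A\<^sup>2 / q + P0 / B)"
      using \<open>B > 0\<close> \<open>q > 0\<close> by (simp add: field_simps power2_eq_square)
    finally show ?thesis using \<open>B > 0\<close> \<open>q > 0\<close> by (simp add: P0_def)
  next
    assume "gauss 1 ^ CARD('n) = - of_real (sqrt CARD('a) ^ CARD('n))"
    then have "complex_of_real (q * B\<^sup>2 * real (dist_count E 0))
      = of_real (B\<^sup>2 * A\<^sup>2 - B * (q * P0 - B\<^sup>2 * A))" using sum by (simp add: B_def)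
    then have "q * B\<^sup>2 * real (dist_count E 0) = B\<^sup>2 * A\<^sup>2 - B * (q * P0 - B\<^sup>2 * A)"
      by (simp only: of_real_eq_iff)
    also have "\<dots> \<le> B\<^sup>2 * A\<^sup>2 + B * (B\<^sup>2 * A)"
      using \<open>B > 0\<close> \<open>q > 0\<close> \<open>P0 \<ge> 0\<close> by (simp add: right_diff_distrib)
    also have "\<dots> = q * B\<^sup>2 * (A\<^sup>2 / q + B * A / q)"
      using \<open>B > 0\<close> \<open>q > 0\<close> by (simp add: field_simps power2_eq_square)
    finally show ?thesis using \<open>B > 0\<close> \<open>q > 0\<close> by simp
  qed
qed

lemma sum_squares_le:
  assumes "\<And>t. 0 \<le> (f t :: real)"
  shows "(\<Sum>x\<in>(UNIV :: 'a set). f (x\<^sup>2)) \<le> 2 * (\<Sum>t\<in>UNIV. f t)"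
proof -
  have "(\<Sum>x\<in>(UNIV :: 'a set). f (x\<^sup>2)) = (\<Sum>t\<in>UNIV. \<Sum>x | x \<in> UNIV \<and> x\<^sup>2 = t. f (x\<^sup>2))"
    by (rule sum.group[symmetric]) auto
  also have "\<dots> = (\<Sum>t\<in>UNIV. real (card {x::'a. x\<^sup>2 = t}) * f t)"
    by (rule sum.cong) auto
  also have "\<dots> \<le> (\<Sum>t\<in>UNIV. 2 * f t)"
    using card_square_roots_le_2 assms by (intro sum_mono mult_right_mono) auto
  finally show ?thesis by (simp add: sum_distrib_left)
qed

text \<open>In odd dimension one Gauss sum is left over; inserting its definition turns the sum over
  the frequencies into a count of the squares among the norms.\<close>
lemma dist_count_0_le_odd:
  fixes E :: "('a ^ 'n::finite) set"
  assumes "odd CARD('n)"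
  defines "B \<equiv> sqrt CARD('a) ^ CARD('n)" and "A \<equiv> real (card E)" and "q \<equiv> real CARD('a)"
  shows "real (dist_count E 0) \<le> A\<^sup>2 / q + B * A / sqrt q"
proof -
  obtain m where m: "CARD('n) = Suc (2 * m)" using assms(1) by (metis oddE Suc_eq_plus1)
  define Q where "Q = q ^ CARD('n)"
  have "q > 0" "Q > 0" "A \<ge> 0" by (simp_all add: q_def Q_def A_def)
  let ?P = "level_energy E"
  define S where "S = (\<Sum>x\<in>UNIV. ?P (x\<^sup>2))"
  have "(\<Sum>k\<in>UNIV - {0}. cnj (gauss k) ^ CARD('n) * fourier ?P k)
      = (\<Sum>k\<in>UNIV - {0}. gauss 1 ^ (2 * m) * (cnj (gauss k) * fourier ?P k))"
  proof (rule sum.cong[OF refl])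
    fix k :: 'a assume "k \<in> UNIV - {0}"
    then have "gauss (- k) ^ (2 * m) = gauss 1 ^ (2 * m)" by (intro gauss_power_even) simp_all
    then show "cnj (gauss k) ^ CARD('n) * fourier ?P k
      = gauss 1 ^ (2 * m) * (cnj (gauss k) * fourier ?P k)"
      by (simp only: cnj_gauss m power_Suc mult_ac)
  qed
  also have "\<dots> = gauss 1 ^ (2 * m) *
      ((\<Sum>k\<in>UNIV. cnj (gauss k) * fourier ?P k) - cnj (gauss 0) * fourier ?P 0)"
    by (simp add: sum_distrib_left[symmetric] sum_diff1)
  also have "(\<Sum>k\<in>UNIV. cnj (gauss k) * fourier ?P k)
      = (\<Sum>k\<in>UNIV. \<Sum>x\<in>UNIV. fourier ?P k * \<psi> (- (k * x\<^sup>2)))"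
    by (simp add: gauss_def cnj_sum cnj_eq sum_distrib_right mult.commute[of "\<psi> _" "fourier _ _"])
  also have "\<dots> = (\<Sum>x\<in>UNIV. \<Sum>k\<in>UNIV. fourier ?P k * \<psi> (- (k * x\<^sup>2)))"
    by (rule sum.swap)
  also have "\<dots> = of_real (q * S)"
    by (simp add: sum_fourier_mult S_def q_def sum_distrib_left)
  also have "cnj (gauss 0) * fourier ?P 0 = of_real (q * (Q * A))"
    by (simp only: gauss_0 fourier_0 sum_level_energy Q_def A_def q_def) simp
  finally have sum: "complex_of_real (q * Q * real (dist_count E 0))
      = of_real (Q * A\<^sup>2) + gauss 1 ^ (2 * m) * of_real (q * (S - Q * A))"
    using dist_count_0_eq[of E]
    by (simp add: q_def[symmetric] Q_def[symmetric] A_def[symmetric] right_diff_distrib)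
  have "S \<ge> 0" by (simp add: S_def sum_nonneg level_energy_nonneg)
  moreover have "S \<le> 2 * (Q * A)"
    unfolding S_def using sum_squares_le[of ?P] by (simp add: sum_level_energy level_energy_nonneg Q_def A_def q_def)
  \<comment> \<open>The sum \<open>S\<close> gives each level weight at most 2 out of a total energy
    \<open>Q * A\<close>, so it differs from \<open>Q * A\<close> by at most
    \<open>Q * A\<close>.\<close>
  ultimately have S: "\<bar>S - Q * A\<bar> \<le> Q * A" by linarith
  have "q * Q * real (dist_count E 0) = norm (complex_of_real (q * Q * real (dist_count E 0)))"
    using \<open>q > 0\<close> \<open>Q > 0\<close> by (simp only: norm_of_real) simp
  also have "\<dots> \<le> norm (complex_of_real (Q * A\<^sup>2)) + norm (gauss 1 ^ (2 * m) * of_real (q * (S - Q * A)))"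
    unfolding sum by (rule norm_triangle_ineq)
  also have "\<dots> = Q * A\<^sup>2 + sqrt q ^ (2 * m) * (q * \<bar>S - Q * A\<bar>)"
    using \<open>q > 0\<close> \<open>Q > 0\<close>
    by (simp only: norm_mult norm_gauss_power one_neq_zero norm_of_real abs_mult not_False_eq_True q_def)
       (simp add: q_def)
  also have "\<dots> \<le> Q * A\<^sup>2 + sqrt q ^ (2 * m) * (q * (Q * A))"
    using S \<open>q > 0\<close> by (intro add_left_mono mult_left_mono) auto
  also have "sqrt q ^ (2 * m) = B / sqrt q"
    using \<open>q > 0\<close> by (simp add: B_def m q_def)
  also have "Q * A\<^sup>2 + B / sqrt q * (q * (Q * A)) = q * Q * (A\<^sup>2 / q + B * A / sqrt q)"
    using \<open>q > 0\<close> by (simp add: distrib_left)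
  finally show ?thesis using \<open>q > 0\<close> \<open>Q > 0\<close> by simp
qed

text \<open>Inversion for the sphere count: the zero frequency contributes q^d and fewer than q
  others have modulus q^(d/2), altogether at most q^d once d is at least 2.\<close>

lemma card_sphere_le:
  assumes "CARD('n) \<ge> 2"
  shows "real CARD('a) * real (card {x :: 'a ^ 'n::finite. sqnorm x = t}) \<le> 2 * real CARD('a) ^ CARD('n)"
proof -
  define f where "f t = (\<Sum>x | x \<in> (UNIV :: ('a ^ 'n) set) \<and> sqnorm x = t. 1 :: real)" for t
  have f: "f t = real (card {x :: 'a ^ 'n. sqnorm x = t})" for t by (simp add: f_def)
  have "f = (\<lambda>t. \<Sum>x | x \<in> (UNIV :: ('a ^ 'n) set) \<and> sqnorm x = t. 1)" by (rule ext) (rule f_def)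
  then have F: "fourier f j = gauss j ^ CARD('n)" for j
    by (simp only: fourier_fibre_sum[OF finite]) (simp add: sum_sqnorm)
  define q where "q = real CARD('a)"
  have "q \<ge> 1" by (simp add: q_def Suc_leI)
  have "q * f t = norm (of_nat CARD('a) * complex_of_real (f t))"
    by (simp add: norm_mult q_def f)
  also have "\<dots> = norm (\<Sum>j\<in>UNIV. gauss j ^ CARD('n) * \<psi> (- (j * t)))"
    by (simp only: sum_fourier_mult[symmetric] F)
  also have "\<dots> \<le> (\<Sum>j\<in>UNIV. norm (gauss j ^ CARD('n)))"
    by (rule order_trans[OF norm_sum]) (simp add: norm_mult norm_eq_1)
  also have "\<dots> = norm (gauss 0 ^ CARD('n)) + (\<Sum>j\<in>UNIV - {0}. norm (gauss j ^ CARD('n)))"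
    by (rule sum.remove) auto
  also have "(\<Sum>j\<in>UNIV - {0}. norm (gauss j ^ CARD('n))) = (\<Sum>j\<in>UNIV - {0::'a}. sqrt q ^ CARD('n))"
    by (rule sum.cong) (auto simp: norm_gauss_power q_def)
  also have "\<dots> \<le> (\<Sum>j\<in>(UNIV::'a set). sqrt q ^ CARD('n))"
    by (rule sum_mono2) (auto simp: q_def)
  also have "\<dots> = q * sqrt q ^ CARD('n)" by (simp add: q_def)
  also have "\<dots> \<le> sqrt q ^ CARD('n) * sqrt q ^ CARD('n)"
  proof (rule mult_right_mono)
    have "q = sqrt q ^ 2" using \<open>q \<ge> 1\<close> by simp
    also have "\<dots> \<le> sqrt q ^ CARD('n)" using assms \<open>q \<ge> 1\<close> by (intro power_increasing) auto
    finally show "q \<le> sqrt q ^ CARD('n)" .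
  qed (use \<open>q \<ge> 1\<close> in simp)
  also have "\<dots> = q ^ CARD('n)" using \<open>q \<ge> 1\<close> by (simp add: power_mult_distrib[symmetric])
  also have "norm (gauss 0 ^ CARD('n)) = q ^ CARD('n)" by (simp add: gauss_0 norm_power q_def)
  finally show ?thesis by (simp add: f q_def)
qed

end

section \<open>Paths in dense graphs\<close>

text \<open>Delete a vertex of degree at most \<open>m\<close> while one exists. Each deletion loses
  at most \<open>2 * m\<close> ordered edges, so the density hypothesis persists and the process
  stops at a nonempty set.\<close>

lemma dense_subset:
  assumes "finite V" and sym: "\<And>u v. R u v \<Longrightarrow> R v u"
    and "2 * m * card V < card {(u, v) \<in> V \<times> V. R u v}"
  shows "\<exists>W\<subseteq>V. W \<noteq> {} \<and> (\<forall>u\<in>W. m < card {v \<in> W. R u v})"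
  using assms(1,3)
proof (induction V rule: finite_psubset_induct)
  case (psubset V)
  show ?case
  proof (cases "\<forall>u\<in>V. m < card {v \<in> V. R u v}")
    case True
    then show ?thesis using psubset.prems by (intro exI[of _ V]) auto
  next
    case False
    then obtain a where a: "a \<in> V" and deg: "card {v \<in> V. R a v} \<le> m" by force
    let ?V = "V - {a}" and ?N = "{v \<in> V. R a v}"
    let ?E = "\<lambda>V. {(u, v) \<in> V \<times> V. R u v}"
    have fin: "finite ?N" "finite (?E ?V)" using \<open>finite V\<close> by (auto intro: finite_subset[of _ "V \<times> V"])
    have "?E V \<subseteq> ?E ?V \<union> (Pair a ` ?N \<union> (\<lambda>v. (v, a)) ` ?N)" using sym by auto
    then have "card (?E V) \<le> card (?E ?V \<union> (Pair a ` ?N \<union> (\<lambda>v. (v, a)) ` ?N))"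
      using fin by (intro card_mono) auto
    also have "\<dots> \<le> card (?E ?V) + (card (Pair a ` ?N) + card ((\<lambda>v. (v, a)) ` ?N))"
      by (intro order_trans[OF card_Un_le] add_left_mono card_Un_le)
    also have "\<dots> \<le> card (?E ?V) + (card ?N + card ?N)"
      using fin by (intro add_left_mono add_mono card_image_le)
    also have "\<dots> \<le> card (?E ?V) + 2 * m" using deg by simp
    finally have "card (?E V) \<le> card (?E ?V) + 2 * m" .
    moreover have "card V = Suc (card ?V)" using a \<open>finite V\<close> by (metis card.remove)
    ultimately have "2 * m * card ?V < card (?E ?V)" using psubset.prems by simp
    moreover have "?V \<subset> V" using a by blast
    ultimately obtain W where "W \<subseteq> ?V" "W \<noteq> {}" "\<forall>u\<in>W. m < card {v \<in> W. R u v}"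
      using psubset.IH[of ?V] by blast
    then show ?thesis by blast
  qed
qed

text \<open>Walks in this graph are pairs of walks with dilation ratio \<open>r\<close>. A pair of
  4-paths is a walk on five vertices whose two projections are both injective.\<close>

definition pair_adj :: "'a::field \<Rightarrow> ('a ^ 'n::finite) \<times> ('a ^ 'n) \<Rightarrow> ('a ^ 'n) \<times> ('a ^ 'n) \<Rightarrow> bool" where
  "pair_adj r p p' \<longleftrightarrow> sqnorm (snd p - snd p') = r * sqnorm (fst p - fst p') \<and>
     sqnorm (fst p - fst p') \<noteq> 0"

lemma pair_adj_sym: "pair_adj r p p' \<Longrightarrow> pair_adj r p' p"
  by (simp add: pair_adj_def sqnorm_minus_commute)

lemma pair_adj_neq: "pair_adj r p p' \<Longrightarrow> r \<noteq> 0 \<Longrightarrow> fst p \<noteq> fst p' \<and> snd p \<noteq> snd p'"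
  by (auto simp: pair_adj_def)

text \<open>Classify the ordered edges by the distance \<open>t\<close> of the first coordinates and
  exchange the two middle points of the quadruple.\<close>

lemma card_pair_adj_eq:
  fixes E :: "('a::{field,finite} ^ 'n::finite) set"
  shows "card {(p, p') \<in> (E \<times> E) \<times> (E \<times> E). pair_adj r p p'}
    = (\<Sum>t\<in>UNIV - {0}. dist_count E t * dist_count E (r * t))"
proof -
  define D where "D t = {(x, y) \<in> E \<times> E. sqnorm (x - y) = t}" for t
  have "(\<Sum>t\<in>UNIV - {0}. dist_count E t * dist_count E (r * t))
      = (\<Sum>t\<in>UNIV - {0}. card (D t \<times> D (r * t)))"
    by (simp add: dist_count_def D_def card_cartesian_product)
  also have "\<dots> = card (\<Union>t\<in>UNIV - {0}. D t \<times> D (r * t))"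
    by (rule card_UN_disjoint[symmetric]) (auto simp: D_def)
  also have "\<dots> = card {(p, p') \<in> (E \<times> E) \<times> (E \<times> E). pair_adj r p p'}"
    by (rule bij_betw_same_card[of "\<lambda>((x, x'), (y, y')). ((x, y), (x', y'))"],
        rule bij_betw_byWitness[where f' = "\<lambda>((x, x'), (y, y')). ((x, y), (x', y'))"])
       (auto simp: D_def pair_adj_def)
  finally show ?thesis ..
qed

text \<open>Once one coordinate of a neighbour is prescribed, the other lies on a determined sphere
  around the corresponding coordinate of \<open>u\<close>.\<close>

lemma card_pair_adj_fibres_le:
  fixes W :: "(('a::{field,finite} ^ 'n::finite) \<times> ('a ^ 'n)) set"
  assumes "r \<noteq> 0" and sphere: "\<And>t. card {x :: 'a ^ 'n. sqnorm x = t} \<le> \<sigma>"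
  shows "card {w \<in> W. pair_adj r u w \<and> fst w = a} \<le> \<sigma>"
    and "card {w \<in> W. pair_adj r u w \<and> snd w = a} \<le> \<sigma>"
proof -
  have "card {w \<in> W. pair_adj r u w \<and> fst w = a}
      \<le> card {x :: 'a ^ 'n. sqnorm x = r * sqnorm (fst u - a)}"
    by (rule card_inj_on_le[of "\<lambda>w. snd u - snd w"]) (auto simp: inj_on_def pair_adj_def)
  then show "card {w \<in> W. pair_adj r u w \<and> fst w = a} \<le> \<sigma>" using sphere order_trans by blast
  have "card {w \<in> W. pair_adj r u w \<and> snd w = a}
      \<le> card {x :: 'a ^ 'n. sqnorm x = sqnorm (snd u - a) / r}"
    by (rule card_inj_on_le[of "\<lambda>w. fst u - fst w"]) (use \<open>r \<noteq> 0\<close> in \<open>auto simp: inj_on_def pair_adj_def\<close>)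
  then show "card {w \<in> W. pair_adj r u w \<and> snd w = a} \<le> \<sigma>" using sphere order_trans by blast
qed

text \<open>Each of the at most three vertices in \<open>F\<close> excludes two spheres of
  neighbours, one per coordinate, hence the bound \<open>6 * \<sigma>\<close>.\<close>

lemma pair_adj_extend:
  fixes W :: "(('a::{field,finite} ^ 'n::finite) \<times> ('a ^ 'n)) set"
  assumes "r \<noteq> 0" and sphere: "\<And>t. card {x :: 'a ^ 'n. sqnorm x = t} \<le> \<sigma>"
    and deg: "6 * \<sigma> < card {w \<in> W. pair_adj r u w}"
    and X: "card F \<le> 3"
  shows "\<exists>w\<in>W. pair_adj r u w \<and> fst w \<notin> fst ` F \<and> snd w \<notin> snd ` F"
proof (rule ccontr)
  assume "\<not> ?thesis"
  then have "{w \<in> W. pair_adj r u w} \<subseteq>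
      (\<Union>p\<in>F. {w \<in> W. pair_adj r u w \<and> fst w = fst p} \<union> {w \<in> W. pair_adj r u w \<and> snd w = snd p})"
    by auto
  then have "card {w \<in> W. pair_adj r u w} \<le>
      card (\<Union>p\<in>F. {w \<in> W. pair_adj r u w \<and> fst w = fst p} \<union> {w \<in> W. pair_adj r u w \<and> snd w = snd p})"
    by (intro card_mono) auto
  also have "\<dots> \<le> (\<Sum>p\<in>F. card ({w \<in> W. pair_adj r u w \<and> fst w = fst p} \<union>
      {w \<in> W. pair_adj r u w \<and> snd w = snd p}))"
    by (rule card_UN_le) simp
  also have "\<dots> \<le> (\<Sum>p\<in>F. \<sigma> + \<sigma>)"
    by (intro sum_mono order_trans[OF card_Un_le] add_mono card_pair_adj_fibres_le[OF assms(1) sphere])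
  also have "\<dots> = card F * (2 * \<sigma>)" by simp
  also have "\<dots> \<le> 3 * (2 * \<sigma>)" using X by (intro mult_right_mono) auto
  finally show False using deg by simp
qed

lemma contains_4path_pairI:
  assumes adj: "pair_adj r p1 p2" "pair_adj r p2 p3" "pair_adj r p3 p4" "pair_adj r p4 p5"
    and in_E: "set [p1, p2, p3, p4, p5] \<subseteq> E \<times> E"
    and dist: "distinct (map fst [p1, p2, p3, p4, p5])" "distinct (map snd [p1, p2, p3, p4, p5])"
  shows "contains_4path_pair r E"
proof -
  \<comment> \<open>Vertices are numbered from 1, list positions from 0.\<close>
  define p where "p i = [p1, p2, p3, p4, p5] ! (i - 1)" for i
  have set: "{1..5} = {1, 2, 3, 4, 5::nat}" by auto
  have p: "p 1 = p1" "p (Suc 0) = p1" "p 2 = p2" "p 3 = p3" "p 4 = p4" "p 5 = p5"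
    by (simp_all add: p_def eval_nat_numeral)
  have "{i, j} \<in> path4_edges \<Longrightarrow> pair_adj r (p j) (p i)" for i j
    using adj adj[THEN pair_adj_sym] by (auto simp: path4_edges_def doubleton_eq_iff p)
  then have "\<forall>i\<in>{1..5}. \<forall>j\<in>{1..5}. {i, j} \<in> path4_edges \<longrightarrow>
      sqnorm (snd (p i) - snd (p j)) = r * sqnorm (fst (p i) - fst (p j)) \<and>
      sqnorm (fst (p i) - fst (p j)) \<noteq> 0"
    using pair_adj_sym unfolding pair_adj_def by blast
  moreover have "\<forall>i\<in>{1..5}. fst (p i) \<in> E \<and> snd (p i) \<in> E" using in_E unfolding set by (auto simp: p)
  moreover have "inj_on (\<lambda>i. fst (p i)) {1..5}" "inj_on (\<lambda>i. snd (p i)) {1..5}"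
    using dist unfolding set by (auto simp: inj_on_def p)
  ultimately show ?thesis unfolding contains_4path_pair_def contains_graph_pair_def
    by (intro exI[of _ "\<lambda>i. fst (p i)"] exI[of _ "\<lambda>i. snd (p i)"]) blast
qed

text \<open>The factor 12 is twice 6: \<open>dense_subset\<close> is used with
  \<open>m = 6 * \<sigma>\<close>, and the path is then grown greedily inside
  \<open>W\<close>.\<close>

lemma contains_4path_pair_of_card:
  fixes E :: "('a::{field,finite} ^ 'n::finite) set"
  assumes "r \<noteq> 0" and sphere: "\<And>t. card {x :: 'a ^ 'n. sqnorm x = t} \<le> \<sigma>"
    and large: "12 * \<sigma> * (card E)\<^sup>2 < (\<Sum>t\<in>UNIV - {0}. dist_count E t * dist_count E (r * t))"
  shows "contains_4path_pair r E"
proof -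
  have "2 * (6 * \<sigma>) * card (E \<times> E) < card {(p, p') \<in> (E \<times> E) \<times> (E \<times> E). pair_adj r p p'}"
    using large unfolding card_pair_adj_eq card_cartesian_product power2_eq_square
    by (simp add: mult.assoc)
  from dense_subset[OF _ pair_adj_sym this] obtain W where W: "W \<subseteq> E \<times> E" "W \<noteq> {}"
    and deg: "\<And>u. u \<in> W \<Longrightarrow> 6 * \<sigma> < card {v \<in> W. pair_adj r u v}" by auto
  have ext: "\<exists>w\<in>W. pair_adj r u w \<and> fst w \<notin> fst ` set ps \<and> snd w \<notin> snd ` set ps"
    if "u \<in> W" "length ps \<le> 3" for u ps
    using pair_adj_extend[OF assms(1) sphere deg[OF that(1)]] that(2) card_length[of ps] by force
  obtain p1 where p1: "p1 \<in> W" using W by blast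
  obtain p2 where p2: "p2 \<in> W" "pair_adj r p1 p2" using ext[OF p1, of "[]"] by auto
  obtain p3 where p3: "p3 \<in> W" "pair_adj r p2 p3" "fst p3 \<noteq> fst p1" "snd p3 \<noteq> snd p1"
    using ext[OF p2(1), of "[p1]"] by auto
  obtain p4 where p4: "p4 \<in> W" "pair_adj r p3 p4" "fst p4 \<notin> fst ` {p1, p2}" "snd p4 \<notin> snd ` {p1, p2}"
    using ext[OF p3(1), of "[p1, p2]"] by auto
  obtain p5 where p5: "p5 \<in> W" "pair_adj r p4 p5" "fst p5 \<notin> fst ` {p1, p2, p3}" "snd p5 \<notin> snd ` {p1, p2, p3}"
    using ext[OF p4(1), of "[p1, p2, p3]"] by auto
  \<comment> \<open>Consecutive vertices differ because adjacency forces nonzero distances, so the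
    greedy choice had to avoid only the vertices before the predecessor, three at most.\<close>
  have neq: "fst p1 \<noteq> fst p2" "fst p2 \<noteq> fst p3" "fst p3 \<noteq> fst p4" "fst p4 \<noteq> fst p5"
    "snd p1 \<noteq> snd p2" "snd p2 \<noteq> snd p3" "snd p3 \<noteq> snd p4" "snd p4 \<noteq> snd p5"
    using pair_adj_neq[OF _ assms(1)] p2 p3 p4 p5 by blast+
  show ?thesis
    by (rule contains_4path_pairI[OF p2(2) p3(2) p4(2) p5(2)])
       (use p1 p2(1) p3(1,3,4) p4(1,3,4) p5(1,3,4) W(1) neq in auto)
qed

section \<open>The main estimate\<close>

context nontrivial_character
begin

lemma card_ge_3: "3 \<le> CARD('a)"
proof -
  have "card {0, 1::'a} \<le> CARD('a)" by (intro card_mono) auto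
  then show ?thesis using odd_card by (cases "CARD('a) = 2") auto
qed

text \<open>The term removed from the full correlation is the square of
  \<open>dist_count E 0\<close>; each bound on that count leaves at least a quarter of the main
  term.\<close>

lemma dist_count_correlation_nonzero_ge:
  fixes E :: "('a ^ 'n::finite) set"
  assumes "r \<noteq> 0" and r: "even CARD('n) \<or> r \<in> nonzero_squares"
    and large: "20 * sqrt CARD('a) ^ CARD('n) \<le> real (card E)"
  shows "(real (card E)) ^ 4 / 4
    \<le> real CARD('a) * (\<Sum>t\<in>UNIV - {0}. real (dist_count E t) * real (dist_count E (r * t)))"
proof -
  define q where "q = real CARD('a)"
  define B where "B = sqrt CARD('a) ^ CARD('n)"
  define A where "A = real (card E)"
  define n where "n = real (dist_count E 0)"
  define N where "N = (\<Sum>t\<in>UNIV. real (dist_count E t) * real (dist_count E (r * t)))"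
  \<comment> \<open>Here \<open>z\<close> is the possibly large isotropic contribution and
    \<open>b\<close> the error scale; the constant 20 serves to make \<open>b\<close> at most
    \<open>A\<^sup>2 / 20\<close>.\<close>
  define z where "z = level_energy E 0 / B"
  define b where "b = B * A"
  have q: "q \<ge> 3" using card_ge_3 by (simp add: q_def)
  have B2: "q ^ CARD('n) = B\<^sup>2"
    by (simp add: q_def B_def power2_eq_square flip: power_mult_distrib)
  have "B > 0" by (simp add: B_def)
  have A: "A \<ge> 20 * B" using large by (simp add: A_def B_def)
  then have "A > 0" using \<open>B > 0\<close> by linarith
  have b: "0 \<le> b" "b \<le> A\<^sup>2 / 20"
    using A \<open>A > 0\<close> \<open>B > 0\<close> by (simp_all add: b_def power2_eq_square)
  then have b2: "b\<^sup>2 \<le> A ^ 4 / 400"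
    using power_mono[OF b(2,1), of 2] by (simp add: power_divide)
  have gauss_eq: "gauss (r * j) ^ CARD('n) = gauss j ^ CARD('n)" for j
  proof (cases "j = 0")
    case False
    from r show ?thesis
    proof
      assume "even CARD('n)"
      then show ?thesis using False \<open>r \<noteq> 0\<close> gauss_power_even by (metis mult_eq_0_iff)
    next
      assume "r \<in> nonzero_squares"
      then obtain s where "r = s\<^sup>2" "s \<noteq> 0" by (auto simp: nonzero_squares_def)
      then show ?thesis using gauss_mult_square[of s j] by (simp add: mult.commute)
    qed
  qed simp
  have "A ^ 4 + q * (level_energy E 0)\<^sup>2 / B\<^sup>2 - B\<^sup>2 * A\<^sup>2 \<le> q * N"
    using dist_count_correlation_ge[OF \<open>r \<noteq> 0\<close> gauss_eq, of E]
    by (simp only: q_def[symmetric] A_def[symmetric] B2 N_def)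
  then have N: "A ^ 4 + q * z\<^sup>2 - b\<^sup>2 \<le> q * N"
    by (simp add: z_def b_def power_divide power_mult_distrib)
  have "level_energy E 0 \<le> (\<Sum>a\<in>UNIV. level_energy E a)"
    by (rule member_le_sum) (auto simp: level_energy_nonneg)
  then have "level_energy E 0 \<le> B\<^sup>2 * A" by (simp only: sum_level_energy q_def[symmetric] A_def[symmetric] B2)
  then have "z \<le> b" using \<open>B > 0\<close> by (simp add: z_def b_def field_simps power2_eq_square)
  have "z \<ge> 0" using \<open>B > 0\<close> by (simp add: z_def level_energy_nonneg)
  have A4: "A ^ 4 = (A\<^sup>2)\<^sup>2" by simp
  have "n \<ge> 0" by (simp add: n_def)
  \<comment> \<open>Even dimension with positive sign, even dimension with negative sign, and odd
    dimension.\<close>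
  consider (hyp) "n \<le> A\<^sup>2 / q + z" | (ell) "n \<le> A\<^sup>2 / q + b / q" | (odd) "n \<le> A\<^sup>2 / q + b / sqrt q"
    using dist_count_0_le_even[of E] dist_count_0_le_odd[of E]
    by (auto simp: n_def q_def A_def b_def B_def z_def)
  \<comment> \<open>The term \<open>q * z\<^sup>2\<close> will cancel against the isotropic term
    kept in \<open>N\<close>, and the reserved \<open>A ^ 4 / 400\<close> pays for
    \<open>b\<^sup>2\<close>.\<close>
  then have "q * n\<^sup>2 \<le> 3 / 4 * A ^ 4 - A ^ 4 / 400 + q * z\<^sup>2"
  proof cases
    case hyp
    then have "n\<^sup>2 \<le> (A\<^sup>2 / q + z)\<^sup>2" using \<open>n \<ge> 0\<close> by (intro power_mono)
    then have "q * n\<^sup>2 \<le> q * (A\<^sup>2 / q + z)\<^sup>2" using q by (intro mult_left_mono) auto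
    also have "\<dots> = A ^ 4 / q + 2 * A\<^sup>2 * z + q * z\<^sup>2"
      using q by (simp add: A4 power2_sum field_simps power2_eq_square)
    also have "A ^ 4 / q \<le> A ^ 4 / 3" using q \<open>A > 0\<close> by (intro divide_left_mono) auto
    also have "2 * A\<^sup>2 * z \<le> 2 * A\<^sup>2 * (A\<^sup>2 / 20)" using b \<open>z \<le> b\<close> by (intro mult_left_mono) auto
    also have "\<dots> = A ^ 4 / 10" by (simp add: A4 power2_eq_square)
    finally show ?thesis using zero_le_power[of A 4] \<open>A > 0\<close> by linarith
  next
    case ell
    have "(A\<^sup>2 + b) / q \<le> (21 / 20 * A\<^sup>2) / q" using b q by (intro divide_right_mono) auto
    then have "n \<le> (21 / 20 * A\<^sup>2) / q" using ell by (simp add: add_divide_distrib)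
    then have "n\<^sup>2 \<le> ((21 / 20 * A\<^sup>2) / q)\<^sup>2" using \<open>n \<ge> 0\<close> by (intro power_mono)
    then have "q * n\<^sup>2 \<le> q * ((21 / 20 * A\<^sup>2) / q)\<^sup>2" using q by (intro mult_left_mono) auto
    also have "\<dots> = (21 / 20)\<^sup>2 * A ^ 4 / q"
      using q by (simp add: A4 field_simps power2_eq_square)
    also have "\<dots> \<le> (21 / 20)\<^sup>2 * A ^ 4 / 3" using q \<open>A > 0\<close> by (intro divide_left_mono) auto
    also have "\<dots> \<le> 3 / 4 * A ^ 4 - A ^ 4 / 400" using \<open>A > 0\<close> by (simp add: power2_eq_square)
    also have "\<dots> \<le> \<dots> + q * z\<^sup>2" using q by simp
    finally show ?thesis .
  next
    case odd
    define s where "s = sqrt q"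
    have s: "s > 0" "q = s\<^sup>2" using q by (simp_all add: s_def)
    \<comment> \<open>As 25/9 is below 3, this follows from q being at least 3; it yields 3/5 + 1/20
      = 13/20 below.\<close>
    have "s \<ge> 5 / 3" unfolding s_def by (rule real_le_rsqrt) (use q in \<open>simp add: power2_eq_square\<close>)
    then have "1 / s \<le> 3 / 5" using s by (simp add: field_simps)
    then have "A\<^sup>2 / s \<le> 3 / 5 * A\<^sup>2" using mult_left_mono[of "1 / s" "3 / 5" "A\<^sup>2"] by simp
    then have le: "A\<^sup>2 / s + b \<le> 13 / 20 * A\<^sup>2" using b by linarith
    have "n\<^sup>2 \<le> (A\<^sup>2 / q + b / s)\<^sup>2" using odd \<open>n \<ge> 0\<close> by (intro power_mono) (simp_all add: s_def)
    then have "q * n\<^sup>2 \<le> q * (A\<^sup>2 / q + b / s)\<^sup>2" using q by (intro mult_left_mono) auto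
    also have "\<dots> = (A\<^sup>2 / s + b)\<^sup>2"
      using s by (simp add: s(2) field_simps power2_eq_square)
    also have "\<dots> \<le> (13 / 20 * A\<^sup>2)\<^sup>2" using le b s by (intro power_mono) auto
    also have "\<dots> = 169 / 400 * A ^ 4" by (simp add: A4 power2_eq_square)
    also have "\<dots> \<le> 3 / 4 * A ^ 4 - A ^ 4 / 400" using \<open>A > 0\<close> by simp
    also have "\<dots> \<le> \<dots> + q * z\<^sup>2" using q by simp
    finally show ?thesis .
  qed
  then have "A ^ 4 / 4 \<le> q * N - q * n\<^sup>2" using N b2 by linarith
  also have "\<dots> = q * (N - n\<^sup>2)" by (simp add: right_diff_distrib)
  also have "N - n\<^sup>2 = (\<Sum>t\<in>UNIV - {0}. real (dist_count E t) * real (dist_count E (r * t)))"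
    by (simp add: N_def n_def sum_diff1 power2_eq_square)
  finally show ?thesis by (simp add: A_def q_def)
qed

text \<open>After multiplication by q the requirement of the greedy argument is at most
  \<open>24 * B\<^sup>2 * A\<^sup>2\<close>, while the edge count supplies \<open>A ^ 4 / 4\<close>,
  which is at least \<open>100 * B\<^sup>2 * A\<^sup>2\<close>.\<close>

lemma contains_4path_pair_of_large:
  fixes E :: "('a ^ 'n::finite) set"
  assumes "r \<noteq> 0" "even CARD('n) \<or> r \<in> nonzero_squares" "CARD('n) \<ge> 2"
    and large: "20 * sqrt CARD('a) ^ CARD('n) \<le> real (card E)"
  shows "contains_4path_pair r E"
proof -
  \<comment> \<open>The maximum is attained, so the bound of \<open>card_sphere_le\<close> passes to
    \<sigma> itself.\<close>
  define \<sigma> where "\<sigma> = Max (range (\<lambda>t. card {x :: 'a ^ 'n. sqnorm x = t}))"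
  have sphere: "card {x :: 'a ^ 'n. sqnorm x = t} \<le> \<sigma>" for t
    unfolding \<sigma>_def by (intro Max_ge) auto
  have "\<sigma> \<in> range (\<lambda>t. card {x :: 'a ^ 'n. sqnorm x = t})"
    unfolding \<sigma>_def by (intro Max_in) auto
  define q where "q = real CARD('a)"
  define A where "A = real (card E)"
  define B where "B = sqrt CARD('a) ^ CARD('n)"
  have q: "q > 0" by (simp add: q_def)
  have "B > 0" by (simp add: B_def)
  have B2: "q ^ CARD('n) = B\<^sup>2"
    by (simp add: q_def B_def power2_eq_square flip: power_mult_distrib)
  have \<sigma>: "q * real \<sigma> \<le> 2 * B\<^sup>2"
    using \<open>\<sigma> \<in> _\<close> card_sphere_le[OF assms(3)] by (auto simp: q_def[symmetric] B2)
  have "A \<ge> 20 * B" using large by (simp add: A_def B_def)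
  then have "A\<^sup>2 \<ge> (20 * B)\<^sup>2" using \<open>B > 0\<close> by (intro power_mono) auto
  then have A2: "A\<^sup>2 \<ge> 400 * B\<^sup>2" by (simp add: power_mult_distrib)
  have "A\<^sup>2 > 0" using \<open>A \<ge> 20 * B\<close> \<open>B > 0\<close> by simp
  have "q * (12 * real \<sigma> * A\<^sup>2) = 12 * (q * real \<sigma>) * A\<^sup>2" by simp
  also have "\<dots> \<le> 12 * (2 * B\<^sup>2) * A\<^sup>2" using \<sigma> by (intro mult_right_mono mult_left_mono) auto
  also have "\<dots> < A\<^sup>2 / 4 * A\<^sup>2"
  proof (rule mult_strict_right_mono)
    have "B\<^sup>2 > 0" using \<open>B > 0\<close> by simp
    then show "12 * (2 * B\<^sup>2) < A\<^sup>2 / 4" using A2 by linarith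
  qed fact
  also have "\<dots> = A ^ 4 / 4" by (simp add: eval_nat_numeral)
  also have "\<dots> \<le> q * (\<Sum>t\<in>UNIV - {0}. real (dist_count E t) * real (dist_count E (r * t)))"
    using dist_count_correlation_nonzero_ge[OF assms(1,2) large] by (simp add: A_def q_def)
  finally have "12 * real \<sigma> * A\<^sup>2 < (\<Sum>t\<in>UNIV - {0}. real (dist_count E t) * real (dist_count E (r * t)))"
    using q by simp
  then have "real (12 * \<sigma> * (card E)\<^sup>2) < real (\<Sum>t\<in>UNIV - {0}. dist_count E t * dist_count E (r * t))"
    by (simp add: A_def)
  then show ?thesis
    by (intro contains_4path_pair_of_card[OF assms(1) sphere]) (simp only: of_nat_less_iff)
qed

end

text \<open>Every threshold is at least 20 q^(d/2), so all five items reduce to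
  \<open>contains_4path_pair_of_large\<close>; what remains is a comparison of powers of q.\<close>

theorem theorem1p6:
  fixes E :: "(('a::{field,finite}) ^ ('n::finite)) set" and r :: 'a
  defines "q \<equiv> CARD('a)" and "d \<equiv> CARD('n)"
  assumes "odd q"
  shows
   "(q \<ge> 5 \<and> d \<in> {2,4} \<and> r \<noteq> 0 \<and> real (card E) \<ge> 36 * real q powr ((2 * real d + 1) / 3)
        \<longrightarrow> contains_4path_pair r E) \<and>
    (d = 3 \<and> r \<in> nonzero_squares \<and> real (card E) \<ge> 9 * real q powr ((2 * real d + 1) / 3)
        \<longrightarrow> contains_4path_pair r E) \<and>
    (d = 5 \<and> r \<in> nonzero_squares \<and> real (card E) \<ge> 12 * real q ^ 3
        \<longrightarrow> contains_4path_pair r E) \<and>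
    (q \<ge> 5 \<and> d \<ge> 6 \<and> even d \<and> r \<noteq> 0 \<and> real (card E) \<ge> 313 * real q powr (real d / 2)
        \<longrightarrow> contains_4path_pair r E) \<and>
    (d \<ge> 7 \<and> odd d \<and> r \<in> nonzero_squares \<and> real (card E) \<ge> 313 * real q powr (real d / 2)
        \<longrightarrow> contains_4path_pair r E)"
proof -
  obtain \<psi> :: "'a \<Rightarrow> complex" where "nontrivial_character \<psi>"
    using ex_nontrivial_additive_character[where 'a = 'a] assms(3)
    unfolding nontrivial_character_def q_def by blast
  then interpret nontrivial_character \<psi> .
  have q: "3 \<le> q" using card_ge_3 by (simp add: q_def)
  have sqrt_power: "sqrt CARD('a) ^ CARD('n) = real q powr (real d / 2)"
    using q by (simp add: powr_half_sqrt[symmetric] powr_powr powr_realpow[symmetric] q_def d_def)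
  have main: "contains_4path_pair r E"
    if "r \<noteq> 0" "even d \<or> r \<in> nonzero_squares" "2 \<le> d" "20 * real q powr (real d / 2) \<le> real (card E)"
    using contains_4path_pair_of_large[of r E] that by (simp add: sqrt_power d_def)
  have sq: "r \<noteq> 0" if "r \<in> nonzero_squares" using that by (simp add: nonzero_squares_def)
  have sqrt_q: "5 / 3 \<le> real q powr (1 / 2)"
  proof -
    have "5 / 3 \<le> sqrt (real q)" by (rule real_le_rsqrt) (use q in \<open>simp add: power2_eq_square\<close>)
    then show ?thesis by (simp add: powr_half_sqrt)
  qed
  have case1: "20 * real q powr (real d / 2) \<le> 36 * real q powr ((2 * real d + 1) / 3)"
    using q by (intro mult_mono powr_mono) auto
  have case3: "20 * real q powr (real d / 2) \<le> 9 * real q powr ((2 * real d + 1) / 3)" if "d = 3"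
  proof -
    \<comment> \<open>The exponents 7/3 and 3/2 differ by 5/6, so the claim is that q^(5/6) is at
      least 20/9; it is checked on sixth powers.\<close>
    have "(20 / 9) ^ 6 \<le> (3 :: real) ^ 5" by (simp add: power_divide)
    also have "\<dots> \<le> real q ^ 5" using q by (intro power_mono) auto
    also have "\<dots> = (real q powr (5 / 6)) ^ 6" using q by (simp add: powr_power)
    \<comment> \<open>The instance 5 stands for the exponent 6, the rule being stated for
      successors.\<close>
    finally have "20 / 9 \<le> real q powr (5 / 6)" by (rule power_le_imp_le_base[of _ 5, simplified]) simp
    then have "20 * real q powr (3 / 2) \<le> 9 * (real q powr (5 / 6) * real q powr (3 / 2))"
      using mult_right_mono[of "20 / 9" "real q powr (5 / 6)" "real q powr (3 / 2)"] by simp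
    then show ?thesis using that by (simp add: powr_add[symmetric])
  qed
  have case5: "20 * real q powr (real d / 2) \<le> 12 * real q ^ 3" if "d = 5"
  proof -
    have "20 * real q powr (5 / 2) \<le> 12 * (real q powr (1 / 2) * real q powr (5 / 2))"
      using mult_right_mono[OF sqrt_q, of "real q powr (5 / 2)"] by simp
    also have "real q powr (1 / 2) * real q powr (5 / 2) = real q ^ 3"
      using q by (simp add: powr_add[symmetric])
    finally show ?thesis using that by simp
  qed
  have case67: "20 * real q powr (real d / 2) \<le> 313 * real q powr (real d / 2)" by simp
  show ?thesis
    using main sq order_trans[OF case1, of "real (card E)"] order_trans[OF case3, of "real (card E)"]
      order_trans[OF case5, of "real (card E)"] order_trans[OF case67, of "real (card E)"]
    by (intro conjI impI; elim conjE; intro main) auto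
qed

end
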